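(* Let $P$ be a finite hereditary permutator, let $\sigma,\tau$ be types with disjunctive weak normal forms $w(\sigma)=\bigvee_{i\in I}\mu_i$ and $w(\tau)=\bigvee_{j\in J}\nu_j$, where the $\mu_i,\nu_j$ are basic intersections. If $\vdash P:\sigma\to\tau$, then for every $i\in I$ there is $j_i\in J$ such that $\vdash P:\mu_i\to\nu_{j_i}$.
   Context: Types: $\sigma ::= \varphi \mid \sigma\to\sigma \mid \sigma\wedge\sigma \mid \sigma\vee\sigma$ ($\varphi$ atomic). A basic type is an atomic or arrow type; a basic intersection is a finite intersection of basic types; at top level $\wedge,\vee$ are taken modulo associativity, commutativity, idempotence. The disjunctive weak normal form $w(\sigma)$ is obtained by applying $(\sigma\vee\tau)\wedge\rho\mapsto(\sigma\wedge\rho)\vee(\tau\wedge\rho)$ at top level (not under arrows) as far as possible: $w(\alpha)=\alpha$ for basic $\alpha$, $w(\sigma\vee\tau)=w(\sigma)\vee w(\tau)$, and if $w(\sigma)=\bigvee_i\mu_i$, $w(\tau)=\bigvee_j\nu_j$ then $w(\sigma\wedge\tau)=\bigvee_{i,j}(\mu_i\wedge\nu_j)$. Typing of linear $\lambda$-terms (each variable occurs exactly once): (Ax) $x:\sigma\vdash x:\sigma$; ($\to$I) from $\Gamma,x:\sigma\vdash M:\tau$ infer $\Gamma\vdash\lambda x.M:\sigma\to\tau$; ($\to$E) from $\Gamma_1\vdash M:\sigma\to\tau$, $\Gamma_2\vdash N:\sigma$ infer $\Gamma_1,\Gamma_2\vdash MN:\tau$; ($\wedge$I) from $\Gamma\vdash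 M:\sigma$, $\Gamma\vdash M:\tau$ infer $\Gamma\vdash M:\sigma\wedge\tau$; ($\wedge$E) from $\Gamma\vdash M:\sigma\wedge\tau$ infer $\Gamma\vdash M:\sigma$ and $\Gamma\vdash M:\tau$; ($\vee$I) from $\Gamma\vdash M:\sigma$ infer $\Gamma\vdash M:\sigma\vee\tau$ and $\Gamma\vdash M:\tau\vee\sigma$; ($\vee$E) from $\Gamma_1,x:\sigma\wedge\theta\vdash M:\rho$, $\Gamma_1,x:\tau\wedge\theta\vdash M:\rho$, $\Gamma_2\vdash N:(\sigma\vee\tau)\wedge\theta$ infer $\Gamma_1,\Gamma_2\vdash M[N/x]:\rho$. Environments are finite sets of $x:\sigma$ with distinct variables; $\Gamma_1,\Gamma_2$ requires disjoint variables. A finite hereditary permutator is a $\lambda$-term which modulo $\beta$-conversion has the form $\lambda xy_1\dots y_n.x(P_1y_{\pi(1)})\dots(P_ny_{\pi(n)})$ ($n\ge0$) with $\pi$ a permutation of $1,\dots,n$ and $P_1,\dots,P_n$ finite hereditary permutators. *)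

theory Defs
  imports Main "HOL-Combinatorics.Permutations"
begin

section \<open>Types\<close>

datatype 'a ty =
    Atom 'a
  | Arrow "'a ty" "'a ty"  (infixr "\<^bold>\<rightarrow>" 60)
  | Inter "'a ty" "'a ty"  (infixr "\<^bold>\<and>" 70)
  | Union "'a ty" "'a ty"  (infixr "\<^bold>\<or>" 65)

fun basic :: "'a ty \<Rightarrow> bool" where
  "basic (Atom _) = True"
| "basic (_ \<^bold>\<rightarrow> _) = True"
| "basic (_ \<^bold>\<and> _) = False"
| "basic (_ \<^bold>\<or> _) = False"

inductive basic_inter :: "'a ty \<Rightarrow> bool" where
  "basic \<alpha> \<Longrightarrow> basic_inter \<alpha>"
| "basic_inter \<sigma> \<Longrightarrow> basic_inter \<tau> \<Longrightarrow> basic_inter (\<sigma> \<^bold>\<and> \<tau>)"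

text \<open>
  Equality of types modulo associativity, commutativity and idempotence at top level.
  There is deliberately no congruence rule for arrows.
\<close>

inductive aci :: "'a ty \<Rightarrow> 'a ty \<Rightarrow> bool"  (infix "\<approx>" 50) where
  aci_refl: "\<sigma> \<approx> \<sigma>"
| aci_sym: "\<sigma> \<approx> \<tau> \<Longrightarrow> \<tau> \<approx> \<sigma>"
| aci_trans: "\<sigma> \<approx> \<tau> \<Longrightarrow> \<tau> \<approx> \<rho> \<Longrightarrow> \<sigma> \<approx> \<rho>"
| aci_inter_cong: "\<sigma> \<approx> \<sigma>' \<Longrightarrow> \<tau> \<approx> \<tau>' \<Longrightarrow> \<sigma> \<^bold>\<and> \<tau> \<approx> \<sigma>' \<^bold>\<and> \<tau>'"
| aci_union_cong: "\<sigma> \<approx> \<sigma>' \<Longrightarrow> \<tau> \<approx> \<tau>' \<Longrightarrow> \<sigma> \<^bold>\<or> \<tau> \<approx> \<sigma>' \<^bold>\<or> \<tau>'"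
| aci_inter_assoc: "(\<sigma> \<^bold>\<and> \<tau>) \<^bold>\<and> \<rho> \<approx> \<sigma> \<^bold>\<and> (\<tau> \<^bold>\<and> \<rho>)"
| aci_inter_comm: "\<sigma> \<^bold>\<and> \<tau> \<approx> \<tau> \<^bold>\<and> \<sigma>"
| aci_inter_idem: "\<sigma> \<^bold>\<and> \<sigma> \<approx> \<sigma>"
| aci_union_assoc: "(\<sigma> \<^bold>\<or> \<tau>) \<^bold>\<or> \<rho> \<approx> \<sigma> \<^bold>\<or> (\<tau> \<^bold>\<or> \<rho>)"
| aci_union_comm: "\<sigma> \<^bold>\<or> \<tau> \<approx> \<tau> \<^bold>\<or> \<sigma>"
| aci_union_idem: "\<sigma> \<^bold>\<or> \<sigma> \<approx> \<sigma>"

text \<open>Finite unions; only meaningful for nonempty lists.\<close>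

definition big_union :: "'a ty list \<Rightarrow> 'a ty"  ("\<^bold>\<Or> _" [66] 66) where
  "\<^bold>\<Or> \<sigma>s = foldl Union (hd \<sigma>s) (tl \<sigma>s)"

fun disjuncts :: "'a ty \<Rightarrow> 'a ty list" where
  "disjuncts (\<sigma> \<^bold>\<or> \<tau>) = disjuncts \<sigma> @ disjuncts \<tau>"
| "disjuncts \<sigma> = [\<sigma>]"

text \<open>The disjunctive weak normal form.\<close>

fun w :: "'a ty \<Rightarrow> 'a ty" where
  "w (\<sigma> \<^bold>\<or> \<tau>) = w \<sigma> \<^bold>\<or> w \<tau>"
| "w (\<sigma> \<^bold>\<and> \<tau>) = \<^bold>\<Or> [\<mu> \<^bold>\<and> \<nu>. \<mu> \<leftarrow> disjuncts (w \<sigma>), \<nu> \<leftarrow> disjuncts (w \<tau>)]"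
| "w \<alpha> = \<alpha>"


section \<open>Lambda terms in de Bruijn notation\<close>

datatype tm = Var nat | App tm tm | Lam tm

fun lift :: "nat \<Rightarrow> tm \<Rightarrow> tm" where
  "lift k (Var i) = Var (if i < k then i else Suc i)"
| "lift k (App M N) = App (lift k M) (lift k N)"
| "lift k (Lam M) = Lam (lift (Suc k) M)"

text \<open>
  \<open>M\<^bold>[N\<^bold>/k\<^bold>]\<close> also removes the binder of \<open>k\<close>: the indices above \<open>k\<close> are decremented.
\<close>

fun subst :: "tm \<Rightarrow> tm \<Rightarrow> nat \<Rightarrow> tm"  ("_\<^bold>[_\<^bold>'/_\<^bold>]" [300, 0, 0] 300) where
  "(Var i)\<^bold>[N\<^bold>/k\<^bold>] = (if i < k then Var i else if i = k then N else Var (i - 1))"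
| "(App M M')\<^bold>[N\<^bold>/k\<^bold>] = App (M\<^bold>[N\<^bold>/k\<^bold>]) (M'\<^bold>[N\<^bold>/k\<^bold>])"
| "(Lam M)\<^bold>[N\<^bold>/k\<^bold>] = Lam (M\<^bold>[lift 0 N\<^bold>/Suc k\<^bold>])"

inductive beta :: "tm \<Rightarrow> tm \<Rightarrow> bool" where
  "beta (App (Lam M) N) (M\<^bold>[N\<^bold>/0\<^bold>])"
| "beta M M' \<Longrightarrow> beta (App M N) (App M' N)"
| "beta N N' \<Longrightarrow> beta (App M N) (App M N')"
| "beta M M' \<Longrightarrow> beta (Lam M) (Lam M')"

abbreviation beta_conv :: "tm \<Rightarrow> tm \<Rightarrow> bool"  (infix "=\<^sub>\<beta>" 50) where
  "M =\<^sub>\<beta> N \<equiv> equivclp beta M N"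

text \<open>
  Under the binders of \<open>x, y\<^sub>1, \<dots>, y\<^sub>n\<close> the variable \<open>x\<close> has index \<open>n\<close> and \<open>y\<^sub>j\<close> has
  index \<open>n - j\<close>.
\<close>

inductive fhp :: "tm \<Rightarrow> bool" where
  "\<pi> permutes {1..n} \<Longrightarrow> (\<forall>i\<in>{1..n}. fhp (Q i)) \<Longrightarrow>
   P =\<^sub>\<beta> (Lam ^^ Suc n)
          (foldl App (Var n)
            (map (\<lambda>i. App ((lift 0 ^^ Suc n) (Q i)) (Var (n - \<pi> i))) [1..<Suc n])) \<Longrightarrow>
   fhp P"


section \<open>Typing\<close>

text \<open>
  An environment maps de Bruijn indices to types; the environments of derivable judgements have
  finite domain. \<open>\<Gamma>, x:\<sigma>\<close> with \<open>x\<close> the variable about to be bound or substituted is \<open>extend \<sigma> \<Gamma>\<close>.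
  Only linear terms are typable, since there is neither weakening nor contraction.
\<close>

type_synonym 'a env = "nat \<Rightarrow> 'a ty option"

definition extend :: "'a ty \<Rightarrow> 'a env \<Rightarrow> 'a env" where
  "extend \<sigma> \<Gamma> = case_nat (Some \<sigma>) \<Gamma>"

inductive typing :: "'a env \<Rightarrow> tm \<Rightarrow> 'a ty \<Rightarrow> bool"  ("_ \<turnstile> _ \<^bold>: _" [50, 50, 50] 50) where
  Ax: "[x \<mapsto> \<sigma>] \<turnstile> Var x \<^bold>: \<sigma>"
| ArrowI: "extend \<sigma> \<Gamma> \<turnstile> M \<^bold>: \<tau> \<Longrightarrow> \<Gamma> \<turnstile> Lam M \<^bold>: \<sigma> \<^bold>\<rightarrow> \<tau>"
| ArrowE: "\<Gamma>\<^sub>1 \<turnstile> M \<^bold>: \<sigma> \<^bold>\<rightarrow> \<tau> \<Longrightarrow> \<Gamma>\<^sub>2 \<turnstile> N \<^bold>: \<sigma> \<Longrightarrow> dom \<Gamma>\<^sub>1 \<inter> dom \<Gamma>\<^sub>2 = {} \<Longrightarrow>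
    \<Gamma>\<^sub>1 ++ \<Gamma>\<^sub>2 \<turnstile> App M N \<^bold>: \<tau>"
| InterI: "\<Gamma> \<turnstile> M \<^bold>: \<sigma> \<Longrightarrow> \<Gamma> \<turnstile> M \<^bold>: \<tau> \<Longrightarrow> \<Gamma> \<turnstile> M \<^bold>: \<sigma> \<^bold>\<and> \<tau>"
| InterE1: "\<Gamma> \<turnstile> M \<^bold>: \<sigma> \<^bold>\<and> \<tau> \<Longrightarrow> \<Gamma> \<turnstile> M \<^bold>: \<sigma>"
| InterE2: "\<Gamma> \<turnstile> M \<^bold>: \<sigma> \<^bold>\<and> \<tau> \<Longrightarrow> \<Gamma> \<turnstile> M \<^bold>: \<tau>"
| UnionI1: "\<Gamma> \<turnstile> M \<^bold>: \<sigma> \<Longrightarrow> \<Gamma> \<turnstile> M \<^bold>: \<sigma> \<^bold>\<or> \<tau>"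
| UnionI2: "\<Gamma> \<turnstile> M \<^bold>: \<sigma> \<Longrightarrow> \<Gamma> \<turnstile> M \<^bold>: \<tau> \<^bold>\<or> \<sigma>"
| UnionE: "extend (\<sigma> \<^bold>\<and> \<theta>) \<Gamma>\<^sub>1 \<turnstile> M \<^bold>: \<rho> \<Longrightarrow> extend (\<tau> \<^bold>\<and> \<theta>) \<Gamma>\<^sub>1 \<turnstile> M \<^bold>: \<rho> \<Longrightarrow>
    \<Gamma>\<^sub>2 \<turnstile> N \<^bold>: (\<sigma> \<^bold>\<or> \<tau>) \<^bold>\<and> \<theta> \<Longrightarrow> dom \<Gamma>\<^sub>1 \<inter> dom \<Gamma>\<^sub>2 = {} \<Longrightarrow>
    \<Gamma>\<^sub>1 ++ \<Gamma>\<^sub>2 \<turnstile> M\<^bold>[N\<^bold>/0\<^bold>] \<^bold>: \<rho>"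

text \<open>
  The rules work on raw types. This loses nothing compared with types modulo
  \<open>\<approx>\<close>: conversion is admissible both for the type of the term and in the environment.
\<close>

lemma extend_empty: "extend \<sigma> Map.empty = [0 \<mapsto> \<sigma>]"
  by (auto simp: extend_def fun_eq_iff split: nat.split)

lemma typing_union_cases:
  assumes "\<And>\<Gamma> M. \<Gamma> \<turnstile> M \<^bold>: \<sigma> \<Longrightarrow> \<Gamma> \<turnstile> M \<^bold>: \<rho>" "\<And>\<Gamma> M. \<Gamma> \<turnstile> M \<^bold>: \<tau> \<Longrightarrow> \<Gamma> \<turnstile> M \<^bold>: \<rho>"
    and N: "\<Gamma> \<turnstile> N \<^bold>: \<sigma> \<^bold>\<or> \<tau>"
  shows "\<Gamma> \<turnstile> N \<^bold>: \<rho>"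
proof -
  let ?\<theta> = "\<sigma> \<^bold>\<or> \<tau>"
  have "extend (\<sigma> \<^bold>\<and> ?\<theta>) Map.empty \<turnstile> Var 0 \<^bold>: \<rho>" "extend (\<tau> \<^bold>\<and> ?\<theta>) Map.empty \<turnstile> Var 0 \<^bold>: \<rho>"
    unfolding extend_empty by (rule assms(1,2), rule InterE1, rule Ax)+
  from UnionE [OF this InterI [OF N N]] show ?thesis
    by simp
qed

lemma typing_aci_iff: "\<sigma> \<approx> \<tau> \<Longrightarrow> \<Gamma> \<turnstile> M \<^bold>: \<sigma> \<longleftrightarrow> \<Gamma> \<turnstile> M \<^bold>: \<tau>"
proof (induction arbitrary: \<Gamma> M rule: aci.induct)
  case aci_inter_cong
  then show ?case by (blast intro: InterI dest: InterE1 InterE2)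
next
  case (aci_union_cong \<sigma> \<sigma>' \<tau> \<tau>')
  have "\<Gamma> \<turnstile> M \<^bold>: \<sigma>' \<^bold>\<or> \<tau>'" if "\<Gamma> \<turnstile> M \<^bold>: \<sigma> \<^bold>\<or> \<tau>"
    by (rule typing_union_cases [OF _ _ that]) (auto simp: aci_union_cong.IH intro: UnionI1 UnionI2)
  moreover have "\<Gamma> \<turnstile> M \<^bold>: \<sigma> \<^bold>\<or> \<tau>" if "\<Gamma> \<turnstile> M \<^bold>: \<sigma>' \<^bold>\<or> \<tau>'"
    by (rule typing_union_cases [OF _ _ that])
      (auto simp flip: aci_union_cong.IH intro: UnionI1 UnionI2)
  ultimately show ?case by blast
next
  case aci_inter_assoc
  show ?case by (blast intro: InterI dest: InterE1 InterE2)
next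
  case aci_inter_comm
  show ?case by (blast intro: InterI dest: InterE1 InterE2)
next
  case aci_inter_idem
  show ?case by (blast intro: InterI dest: InterE1)
next
  case (aci_union_assoc \<sigma> \<tau> \<rho>)
  have "\<Gamma> \<turnstile> M \<^bold>: \<sigma> \<^bold>\<or> \<tau> \<^bold>\<or> \<rho>" if "\<Gamma> \<turnstile> M \<^bold>: \<sigma> \<^bold>\<or> \<tau>" for \<Gamma> M
    by (rule typing_union_cases [OF _ _ that]) (blast intro: UnionI1 UnionI2)+
  moreover have "\<Gamma> \<turnstile> M \<^bold>: (\<sigma> \<^bold>\<or> \<tau>) \<^bold>\<or> \<rho>" if "\<Gamma> \<turnstile> M \<^bold>: \<tau> \<^bold>\<or> \<rho>" for \<Gamma> M
    by (rule typing_union_cases [OF _ _ that]) (blast intro: UnionI1 UnionI2)+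
  ultimately show ?case
    using typing_union_cases [of "\<sigma> \<^bold>\<or> \<tau>" "\<sigma> \<^bold>\<or> \<tau> \<^bold>\<or> \<rho>" \<rho>]
      typing_union_cases [of \<sigma> "(\<sigma> \<^bold>\<or> \<tau>) \<^bold>\<or> \<rho>" "\<tau> \<^bold>\<or> \<rho>"]
    by (blast intro: UnionI1 UnionI2)
next
  case (aci_union_comm \<sigma> \<tau>)
  have "\<Gamma> \<turnstile> M \<^bold>: \<tau> \<^bold>\<or> \<sigma>" if "\<Gamma> \<turnstile> M \<^bold>: \<sigma> \<^bold>\<or> \<tau>" for \<Gamma> M and \<sigma> \<tau> :: "'a ty"
    by (rule typing_union_cases [OF _ _ that]) (blast intro: UnionI1 UnionI2)+
  then show ?case by blast
next
  case (aci_union_idem \<sigma>)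
  show ?case by (blast intro: UnionI1 typing_union_cases [of \<sigma> \<sigma> \<sigma>])
qed auto

definition env_aci :: "'a env \<Rightarrow> 'a env \<Rightarrow> bool" where
  "env_aci \<Gamma> \<Delta> \<longleftrightarrow> (\<forall>x. rel_option (\<approx>) (\<Gamma> x) (\<Delta> x))"

lemma env_aci_extend: "env_aci \<Gamma> \<Delta> \<Longrightarrow> env_aci (extend \<sigma> \<Gamma>) (extend \<sigma> \<Delta>)"
  by (auto simp: env_aci_def extend_def aci_refl split: nat.split)

lemma env_aci_add_split:
  assumes "env_aci (\<Gamma>\<^sub>1 ++ \<Gamma>\<^sub>2) \<Delta>" "dom \<Gamma>\<^sub>1 \<inter> dom \<Gamma>\<^sub>2 = {}"
  obtains \<Delta>\<^sub>1 \<Delta>\<^sub>2 where "\<Delta> = \<Delta>\<^sub>1 ++ \<Delta>\<^sub>2" "dom \<Delta>\<^sub>1 \<inter> dom \<Delta>\<^sub>2 = {}" "env_aci \<Gamma>\<^sub>1 \<Delta>\<^sub>1" "env_aci \<Gamma>\<^sub>2 \<Delta>\<^sub>2"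
proof
  have rel: "rel_option (\<approx>) ((\<Gamma>\<^sub>1 ++ \<Gamma>\<^sub>2) x) (\<Delta> x)" for x
    using assms(1) by (simp add: env_aci_def)
  show "\<Delta> = \<Delta> |` dom \<Gamma>\<^sub>1 ++ \<Delta> |` dom \<Gamma>\<^sub>2"
  proof
    fix x
    show "\<Delta> x = (\<Delta> |` dom \<Gamma>\<^sub>1 ++ \<Delta> |` dom \<Gamma>\<^sub>2) x"
      using rel [of x]
      by (cases "\<Gamma>\<^sub>1 x"; cases "\<Gamma>\<^sub>2 x"; cases "\<Delta> x") (auto simp: map_add_def restrict_map_def)
  qed
  show "dom (\<Delta> |` dom \<Gamma>\<^sub>1) \<inter> dom (\<Delta> |` dom \<Gamma>\<^sub>2) = {}"
    using assms(2) by auto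
  show "env_aci \<Gamma>\<^sub>1 (\<Delta> |` dom \<Gamma>\<^sub>1)"
    unfolding env_aci_def
  proof
    fix x
    have "x \<notin> dom \<Gamma>\<^sub>1 \<or> \<Gamma>\<^sub>2 x = None" using assms(2) by auto
    then show "rel_option (\<approx>) (\<Gamma>\<^sub>1 x) ((\<Delta> |` dom \<Gamma>\<^sub>1) x)"
      using rel [of x] by (cases "\<Gamma>\<^sub>1 x") (auto simp: map_add_def restrict_map_def)
  qed
  show "env_aci \<Gamma>\<^sub>2 (\<Delta> |` dom \<Gamma>\<^sub>2)"
    unfolding env_aci_def
  proof
    fix x
    show "rel_option (\<approx>) (\<Gamma>\<^sub>2 x) ((\<Delta> |` dom \<Gamma>\<^sub>2) x)"
      using rel [of x] by (cases "\<Gamma>\<^sub>2 x") (auto simp: map_add_def restrict_map_def)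
  qed
qed

lemma typing_env_aci: "\<Gamma> \<turnstile> M \<^bold>: \<tau> \<Longrightarrow> env_aci \<Gamma> \<Delta> \<Longrightarrow> \<Delta> \<turnstile> M \<^bold>: \<tau>"
proof (induction arbitrary: \<Delta> rule: typing.induct)
  case (Ax x \<sigma>)
  then have rel: "rel_option (\<approx>) ([x \<mapsto> \<sigma>] y) (\<Delta> y)" for y
    by (simp add: env_aci_def)
  obtain \<sigma>' where "\<Delta> x = Some \<sigma>'" "\<sigma> \<approx> \<sigma>'"
    using rel [of x] by (cases "\<Delta> x") auto
  moreover have "\<Delta> y = None" if "y \<noteq> x" for y
    using rel [of y] that by (cases "\<Delta> y") auto
  ultimately have "\<Delta> = [x \<mapsto> \<sigma>']" by auto
  then show ?case
    using typing_aci_iff [OF \<open>\<sigma> \<approx> \<sigma>'\<close>] typing.Ax by metis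
next
  case ArrowI
  then show ?case by (blast intro: typing.ArrowI env_aci_extend)
next
  case ArrowE
  then show ?case by (blast elim: env_aci_add_split intro: typing.ArrowE)
next
  case UnionE
  then show ?case by (blast elim: env_aci_add_split intro: typing.UnionE env_aci_extend)
qed (blast intro: typing.intros)+

end

theory Submission
  imports Defs "HOL-Library.Confluence"
begin

text \<open>
  Fix a closed linear \<open>P\<close> and a variable \<open>x : \<mu>\<^sub>i\<close>. A logical relation over the terms whose only
  possible free variable is \<open>x\<close> interprets intersection and union as intersection and union of
  sets, so that it does not distinguish a type from its disjunctive weak normal form, and a
  reducible term of union type has one of the disjuncts as its type. The obstacle is \<open>x\<close> itself:
  \<open>x A\<close> may have a union type without having one of its members. For a hereditary permutator this
  never matters, since in every reduct of \<open>P x\<close> the arguments of \<open>x\<close> contain bound variables; the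
  relation is restricted to such terms, and then \<open>x\<close> is reducible at \<open>\<mu>\<^sub>i\<close> for trivial reasons. Hence
  \<open>P x\<close> has some type \<open>\<nu>\<^sub>j\<close> after weak head reduction. The result is transferred to \<open>P\<close>
  because types are preserved by weak head expansion of linear terms.
\<close>

section \<open>Parallel renaming and substitution\<close>

text \<open>That \<open>P\<close> is merely beta-convertible to its canonical form shapes the proof.
  Types do not survive expansion under binders, so \<open>P\<close> cannot be replaced by that form
  and has to be typed through its own weak head reducts. The canonical form enters only by way of
  confluence: an application of the variable to a closed argument, once present in a linear term,
  persists under reduction, whereas no reduct of the canonical body contains one.

  The other obstacle is union elimination. Its conclusion is a substitution instance, so derivations
  do not follow the shape of the term. To undo a head redex, a derivation for \<open>sub s B\<close>
  has to be split into one for \<open>B\<close> and one for each \<open>s v\<close>. If it ends with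
  a union elimination, the same term is a substitution instance in two ways, and the positions of
  the two substitutions relative to each other have to be analysed.\<close>

lemma ex_nat: "(\<exists>n. P n) \<longleftrightarrow> P 0 \<or> (\<exists>n. P (Suc n))"
  by (metis not0_implies_Suc)

fun ren :: "(nat \<Rightarrow> nat) \<Rightarrow> tm \<Rightarrow> tm" where
  "ren r (Var i) = Var (r i)"
| "ren r (App M N) = App (ren r M) (ren r N)"
| "ren r (Lam M) = Lam (ren (case_nat 0 (\<lambda>i. Suc (r i))) M)"

definition up :: "(nat \<Rightarrow> tm) \<Rightarrow> nat \<Rightarrow> tm" where
  "up s = case_nat (Var 0) (\<lambda>i. ren Suc (s i))"

lemma up_simps [simp]: "up s 0 = Var 0" "up s (Suc i) = ren Suc (s i)"
  by (simp_all add: up_def)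

fun sub :: "(nat \<Rightarrow> tm) \<Rightarrow> tm \<Rightarrow> tm" where
  "sub s (Var i) = s i"
| "sub s (App M N) = App (sub s M) (sub s N)"
| "sub s (Lam M) = Lam (sub (up s) M)"

fun fv :: "tm \<Rightarrow> nat set" where
  "fv (Var i) = {i}"
| "fv (App M N) = fv M \<union> fv N"
| "fv (Lam M) = {i. Suc i \<in> fv M}"

fun lin :: "tm \<Rightarrow> bool" where
  "lin (Var i) \<longleftrightarrow> True"
| "lin (App M N) \<longleftrightarrow> lin M \<and> lin N \<and> fv M \<inter> fv N = {}"
| "lin (Lam M) \<longleftrightarrow> lin M \<and> 0 \<in> fv M"

lemma ren_cong: "(\<And>i. i \<in> fv M \<Longrightarrow> r i = r' i) \<Longrightarrow> ren r M = ren r' M"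
proof (induction M arbitrary: r r')
  case (Lam M)
  have "ren (case_nat 0 (\<lambda>i. Suc (r i))) M = ren (case_nat 0 (\<lambda>i. Suc (r' i))) M"
    by (rule Lam.IH) (use Lam.prems in \<open>auto split: nat.split\<close>)
  then show ?case by simp
next
  case (App M N)
  have "ren r M = ren r' M" "ren r N = ren r' N"
    by (rule App.IH; use App.prems in simp)+
  then show ?case by simp
qed simp

lemma sub_cong: "(\<And>i. i \<in> fv M \<Longrightarrow> s i = s' i) \<Longrightarrow> sub s M = sub s' M"
proof (induction M arbitrary: s s')
  case (Lam M)
  have "sub (up s) M = sub (up s') M"
    by (rule Lam.IH) (use Lam.prems in \<open>auto simp: up_def split: nat.split\<close>)
  then show ?case by simp
next
  case (App M N)
  have "sub s M = sub s' M" "sub s N = sub s' N"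
    by (rule App.IH; use App.prems in simp)+
  then show ?case by simp
qed simp

lemma ren_sub_Var: "ren r M = sub (\<lambda>i. Var (r i)) M"
proof (induction M arbitrary: r)
  case (Lam M)
  have "up (\<lambda>i. Var (r i)) = (\<lambda>i. Var (case_nat 0 (\<lambda>i. Suc (r i)) i))"
    by (auto simp: up_def fun_eq_iff split: nat.split)
  then show ?case by (simp add: Lam)
qed auto

lemma sub_Var [simp]: "sub Var M = M"
proof -
  have "up Var = Var" by (auto simp: up_def fun_eq_iff split: nat.split)
  then show ?thesis by (induction M) auto
qed

lemma ren_id: "(\<And>i. i \<in> fv M \<Longrightarrow> r i = i) \<Longrightarrow> ren r M = M"
  using sub_cong [of M "\<lambda>i. Var (r i)" Var] by (simp add: ren_sub_Var)

lemma sub_id: "(\<And>i. i \<in> fv M \<Longrightarrow> s i = Var i) \<Longrightarrow> sub s M = M"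
  using sub_cong [of M s Var] by simp

lemma sub_ren: "sub s (ren r M) = sub (\<lambda>i. s (r i)) M"
proof (induction M arbitrary: s r)
  case (Lam M)
  have "(\<lambda>i. up s (case_nat 0 (\<lambda>i. Suc (r i)) i)) = up (\<lambda>i. s (r i))"
    by (auto simp: up_def fun_eq_iff split: nat.split)
  then show ?case by (simp add: Lam)
qed auto

lemma ren_ren: "ren r (ren q M) = ren (\<lambda>i. r (q i)) M"
  by (simp add: ren_sub_Var [of r] ren_sub_Var [of "\<lambda>i. r (q i)"] sub_ren)

lemma ren_sub: "ren r (sub s M) = sub (\<lambda>i. ren r (s i)) M"
proof (induction M arbitrary: s r)
  case (Lam M)
  have "(\<lambda>i. ren (case_nat 0 (\<lambda>i. Suc (r i))) (up s i)) = up (\<lambda>i. ren r (s i))"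
    by (auto simp: up_def fun_eq_iff ren_ren split: nat.split)
  then show ?case by (simp add: Lam)
qed auto

lemma sub_sub: "sub s (sub t M) = sub (\<lambda>i. sub s (t i)) M"
proof (induction M arbitrary: s t)
  case (Lam M)
  have "(\<lambda>i. sub (up s) (up t i)) = up (\<lambda>i. sub s (t i))"
    by (auto simp: up_def fun_eq_iff sub_ren ren_sub split: nat.split)
  then show ?case by (simp add: Lam)
qed auto

lemma fv_sub: "fv (sub s M) = (\<Union>v\<in>fv M. fv (s v))"
  and fv_ren: "fv (ren r M) = r ` fv M"
proof -
  show ren: "fv (ren r M) = r ` fv M" for r M
  proof (induction M arbitrary: r)
    case (Lam M)
    have "Suc i \<in> case_nat 0 (\<lambda>i. Suc (r i)) ` fv M \<longleftrightarrow> i \<in> r ` {i. Suc i \<in> fv M}" for i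
      unfolding image_iff Bex_def by (subst ex_nat) auto
    then show ?case by (auto simp: Lam)
  qed auto
  show "fv (sub s M) = (\<Union>v\<in>fv M. fv (s v))"
  proof (induction M arbitrary: s)
    case (Lam M)
    have "(\<exists>v\<in>fv M. Suc i \<in> fv (up s v)) \<longleftrightarrow> (\<exists>v. Suc v \<in> fv M \<and> i \<in> fv (s v))" for i
      unfolding Bex_def by (subst ex_nat) (auto simp: ren)
    then show ?case by (auto simp: Lam)
  qed auto
qed

section \<open>Agreement with the given lifting and substitution\<close>

lemma lift_ren: "lift k M = ren (\<lambda>i. if i < k then i else Suc i) M"
proof (induction M arbitrary: k)
  case (Lam M)
  have "(\<lambda>i. if i < Suc k then i else Suc i) = case_nat 0 (\<lambda>i. Suc (if i < k then i else Suc i))"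
    by (auto simp: fun_eq_iff split: nat.split)
  then show ?case by (simp add: Lam)
qed auto

lemma lift_0: "lift 0 = ren Suc"
  by (auto simp: lift_ren fun_eq_iff intro: ren_cong)

lemma subst_sub: "M\<^bold>[N\<^bold>/k\<^bold>] = sub (\<lambda>i. if i < k then Var i else if i = k then N else Var (i - 1)) M"
proof (induction M arbitrary: N k)
  case (Lam M)
  have "(\<lambda>i. if i < Suc k then Var i else if i = Suc k then lift 0 N else Var (i - 1)) =
      up (\<lambda>i. if i < k then Var i else if i = k then N else Var (i - 1))"
    by (auto simp: up_def fun_eq_iff lift_0 split: nat.split)
  then show ?case by (simp add: Lam)
qed auto

lemma subst_0: "M\<^bold>[N\<^bold>/0\<^bold>] = sub (case_nat N Var) M"
  unfolding subst_sub by (rule sub_cong) (auto split: nat.split)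

text \<open>With \<open>sub_beta\<close>, this brings both orders of substituting and instantiating
  index 0 to one simultaneous substitution. Union elimination and beta-contraction thereby commute
  with substitution.\<close>

lemma sub_up_beta: "sub (case_nat N Var) (sub (up s) M) = sub (case_nat N s) M"
  unfolding sub_sub by (rule sub_cong) (auto simp: sub_ren split: nat.split)

lemma sub_beta: "sub s (sub (case_nat N Var) M) = sub (case_nat (sub s N) s) M"
  unfolding sub_sub by (rule sub_cong) (auto split: nat.split)

section \<open>Preservation of linearity\<close>

lemma lin_ren: "lin M \<Longrightarrow> inj_on r (fv M) \<Longrightarrow> lin (ren r M)"
proof (induction M arbitrary: r)
  case (App M N)
  have "inj_on r (fv M)" "inj_on r (fv N)" "r ` fv M \<inter> r ` fv N = {}"
    using App.prems by (auto simp: inj_on_def)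
  with App.IH App.prems(1) show ?case by (simp add: fv_ren)
next
  case (Lam M)
  have "inj_on (case_nat 0 (\<lambda>i. Suc (r i))) (fv M)"
    using Lam.prems(2) by (auto simp: inj_on_def split: nat.splits)
  with Lam show ?case by (force simp: fv_ren)
qed auto

text \<open>The side condition that keeps the two parts of an application disjoint after
  substitution. It is relative to a set so that it can be restricted to the variables of a
  subterm.\<close>

definition disj :: "(nat \<Rightarrow> tm) \<Rightarrow> nat set \<Rightarrow> bool" where
  "disj s X \<longleftrightarrow> (\<forall>u\<in>X. \<forall>v\<in>X. u \<noteq> v \<longrightarrow> fv (s u) \<inter> fv (s v) = {})"

lemma disj_subset: "disj s X \<Longrightarrow> Y \<subseteq> X \<Longrightarrow> disj s Y"
  by (auto simp: disj_def)

lemma disj_up: "disj s {i. Suc i \<in> X} \<Longrightarrow> disj (up s) X"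
  unfolding disj_def
proof (intro ballI impI)
  fix u v
  assume "\<forall>u\<in>{i. Suc i \<in> X}. \<forall>v\<in>{i. Suc i \<in> X}. u \<noteq> v \<longrightarrow> fv (s u) \<inter> fv (s v) = {}"
    and "u \<in> X" "v \<in> X" "u \<noteq> v"
  then show "fv (up s u) \<inter> fv (up s v) = {}"
    by (cases u; cases v) (auto simp: fv_ren)
qed

lemma disj_Var [simp]: "disj Var X"
  by (simp add: disj_def)

lemma disj_scons:
  assumes "disj s {i. Suc i \<in> X}" "\<And>i. 0 \<in> X \<Longrightarrow> Suc i \<in> X \<Longrightarrow> fv N \<inter> fv (s i) = {}"
  shows "disj (case_nat N s) X"
  unfolding disj_def
proof (intro ballI impI)
  fix u v
  assume "u \<in> X" "v \<in> X" "u \<noteq> v"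
  then show "fv (case_nat N s u) \<inter> fv (case_nat N s v) = {}"
    using assms by (cases u; cases v) (auto simp: disj_def)
qed

section \<open>Typing with total environments\<close>

lemma disj_fv_sub:
  assumes "disj s (fv M \<union> fv N)" "fv M \<inter> fv N = {}"
  shows "fv (sub s M) \<inter> fv (sub s N) = {}"
proof -
  have "fv (s u) \<inter> fv (s v) = {}" if "u \<in> fv M" "v \<in> fv N" for u v
  proof -
    have "u \<noteq> v" using that assms(2) by auto
    with that assms(1) show ?thesis unfolding disj_def by blast
  qed
  then show ?thesis unfolding fv_sub by blast
qed

lemma lin_sub: "lin M \<Longrightarrow> \<forall>v\<in>fv M. lin (s v) \<Longrightarrow> disj s (fv M) \<Longrightarrow> lin (sub s M)"
proof (induction M arbitrary: s)
  case (App M N)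
  have "lin (sub s M)" "lin (sub s N)"
    using App.prems by (auto intro!: App.IH elim: disj_subset)
  moreover have "fv (sub s M) \<inter> fv (sub s N) = {}"
    using App.prems by (simp add: disj_fv_sub)
  ultimately show ?case by simp
next
  case (Lam M)
  have "\<forall>v\<in>fv M. lin (up s v)"
    using Lam.prems(2) by (auto simp: up_def lin_ren split: nat.splits)
  with Lam show ?case by (force simp: fv_sub disj_up)
qed simp

text \<open>
  The environment is total: it also types variables that do not occur in the term. The
  side conditions keep the terms linear, so the splitting of environments in \<open>typing\<close> becomes
  the restriction of one environment to the free variables of the two parts.
\<close>

inductive ltyping :: "(nat \<Rightarrow> 'a ty) \<Rightarrow> tm \<Rightarrow> 'a ty \<Rightarrow> bool"  ("_ \<tturnstile> _ \<^bold>: _" [50, 50, 50] 50) where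
  Ax: "E x = \<sigma> \<Longrightarrow> E \<tturnstile> Var x \<^bold>: \<sigma>"
| ArrowI: "case_nat \<sigma> E \<tturnstile> M \<^bold>: \<tau> \<Longrightarrow> 0 \<in> fv M \<Longrightarrow> E \<tturnstile> Lam M \<^bold>: \<sigma> \<^bold>\<rightarrow> \<tau>"
| ArrowE: "E \<tturnstile> M \<^bold>: \<sigma> \<^bold>\<rightarrow> \<tau> \<Longrightarrow> E \<tturnstile> N \<^bold>: \<sigma> \<Longrightarrow> fv M \<inter> fv N = {} \<Longrightarrow> E \<tturnstile> App M N \<^bold>: \<tau>"
| InterI: "E \<tturnstile> M \<^bold>: \<sigma> \<Longrightarrow> E \<tturnstile> M \<^bold>: \<tau> \<Longrightarrow> E \<tturnstile> M \<^bold>: \<sigma> \<^bold>\<and> \<tau>"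
| InterE1: "E \<tturnstile> M \<^bold>: \<sigma> \<^bold>\<and> \<tau> \<Longrightarrow> E \<tturnstile> M \<^bold>: \<sigma>"
| InterE2: "E \<tturnstile> M \<^bold>: \<sigma> \<^bold>\<and> \<tau> \<Longrightarrow> E \<tturnstile> M \<^bold>: \<tau>"
| UnionI1: "E \<tturnstile> M \<^bold>: \<sigma> \<Longrightarrow> E \<tturnstile> M \<^bold>: \<sigma> \<^bold>\<or> \<tau>"
| UnionI2: "E \<tturnstile> M \<^bold>: \<sigma> \<Longrightarrow> E \<tturnstile> M \<^bold>: \<tau> \<^bold>\<or> \<sigma>"
| UnionE: "case_nat (\<sigma> \<^bold>\<and> \<theta>) E \<tturnstile> M \<^bold>: \<rho> \<Longrightarrow> case_nat (\<tau> \<^bold>\<and> \<theta>) E \<tturnstile> M \<^bold>: \<rho> \<Longrightarrow>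
    E \<tturnstile> N \<^bold>: (\<sigma> \<^bold>\<or> \<tau>) \<^bold>\<and> \<theta> \<Longrightarrow> 0 \<in> fv M \<Longrightarrow> \<forall>i. Suc i \<in> fv M \<longrightarrow> i \<notin> fv N \<Longrightarrow>
    E \<tturnstile> sub (case_nat N Var) M \<^bold>: \<rho>"

lemma Suc_in_fv_sub_up: "Suc i \<in> fv (sub (up s) M) \<longleftrightarrow> (\<exists>j. Suc j \<in> fv M \<and> i \<in> fv (s j))"
  using fv_sub [of s "Lam M"] by auto

lemma inj_on_up: "inj_on r {i. Suc i \<in> X} \<Longrightarrow> inj_on (case_nat 0 (\<lambda>i. Suc (r i))) X"
proof (rule inj_onI)
  fix u v
  assume "inj_on r {i. Suc i \<in> X}" "u \<in> X" "v \<in> X"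
    "case_nat 0 (\<lambda>i. Suc (r i)) u = case_nat 0 (\<lambda>i. Suc (r i)) v"
  then show "u = v" by (cases u; cases v) (auto simp: inj_on_def)
qed

lemma disj_scons_Var: "\<forall>i. Suc i \<in> X \<longrightarrow> i \<notin> fv N \<Longrightarrow> disj (case_nat N Var) X"
  by (rule disj_scons) auto

lemma fv_scons:
  "fv (sub (case_nat N s) M) = (if 0 \<in> fv M then fv N else {}) \<union> (\<Union>i\<in>{i. Suc i \<in> fv M}. fv (s i))"
  unfolding fv_sub by (auto split: nat.splits)

lemma ltyping_lin: "E \<tturnstile> M \<^bold>: \<rho> \<Longrightarrow> lin M"
proof (induction rule: ltyping.induct)
  case (UnionE \<sigma> \<theta> E M \<rho> \<tau> N)
  show ?case
    by (rule lin_sub) (use UnionE in \<open>auto simp: disj_scons_Var split: nat.split\<close>)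
qed auto

text \<open>Injectivity is required because identifying two free variables would destroy
  linearity.\<close>

lemma ltyping_ren:
  "E \<tturnstile> M \<^bold>: \<rho> \<Longrightarrow> \<forall>v\<in>fv M. F (r v) = E v \<Longrightarrow> inj_on r (fv M) \<Longrightarrow> F \<tturnstile> ren r M \<^bold>: \<rho>"
proof (induction arbitrary: F r rule: ltyping.induct)
  case (ArrowI \<sigma> E M \<tau>)
  have "case_nat \<sigma> F \<tturnstile> ren (case_nat 0 (\<lambda>i. Suc (r i))) M \<^bold>: \<tau>"
    by (rule ArrowI.IH) (use ArrowI.prems in \<open>auto simp: inj_on_up split: nat.splits\<close>)
  then show ?case
    using ArrowI.hyps by (force simp: fv_ren intro!: ltyping.ArrowI)
next
  case (ArrowE E M \<sigma> \<tau> N)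
  have "F \<tturnstile> ren r M \<^bold>: \<sigma> \<^bold>\<rightarrow> \<tau>" "F \<tturnstile> ren r N \<^bold>: \<sigma>"
    using ArrowE.prems by (auto intro!: ArrowE.IH simp: inj_on_def)
  moreover have "r ` fv M \<inter> r ` fv N = {}"
    using ArrowE.prems(2) ArrowE.hyps(3) by (simp add: inj_on_image_Int [symmetric])
  ultimately show ?case by (metis ltyping.ArrowE fv_ren ren.simps(2))
next
  case (UnionE \<sigma> \<theta> E M \<rho> \<tau> N)
  let ?r = "case_nat 0 (\<lambda>i. Suc (r i))"
  have fv: "fv (sub (case_nat N Var) M) = fv N \<union> {i. Suc i \<in> fv M}"
    using UnionE.hyps by (auto simp: fv_scons)
  have inj: "inj_on ?r (fv M)"
    using UnionE.prems(2) unfolding fv by (auto intro: inj_on_up elim: inj_on_subset)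
  have eq: "\<forall>v\<in>fv M. case_nat \<alpha> F (?r v) = case_nat \<alpha> E v" for \<alpha>
    using UnionE.prems(1) unfolding fv by (auto split: nat.splits)
  have "F \<tturnstile> sub (case_nat (ren r N) Var) (ren ?r M) \<^bold>: \<rho>"
  proof (rule ltyping.UnionE)
    show "case_nat (\<sigma> \<^bold>\<and> \<theta>) F \<tturnstile> ren ?r M \<^bold>: \<rho>" "case_nat (\<tau> \<^bold>\<and> \<theta>) F \<tturnstile> ren ?r M \<^bold>: \<rho>"
      by (rule UnionE.IH(1,2) [OF eq inj])+
    show "F \<tturnstile> ren r N \<^bold>: (\<sigma> \<^bold>\<or> \<tau>) \<^bold>\<and> \<theta>"
      by (rule UnionE.IH) (use UnionE.prems fv in \<open>auto simp: inj_on_def\<close>)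
    show "0 \<in> fv (ren ?r M)" using UnionE.hyps by (force simp: fv_ren)
    show "\<forall>i. Suc i \<in> fv (ren ?r M) \<longrightarrow> i \<notin> fv (ren r N)"
    proof (intro allI impI notI)
      fix i assume "Suc i \<in> fv (ren ?r M)" "i \<in> fv (ren r N)"
      then obtain j k where "Suc j \<in> fv M" "i = r j" "k \<in> fv N" "i = r k"
        by (auto simp: fv_ren split: nat.splits)
      with UnionE.prems(2) have "j = k" unfolding fv by (auto simp: inj_on_def)
      with \<open>Suc j \<in> fv M\<close> \<open>k \<in> fv N\<close> UnionE.hyps show False by auto
    qed
  qed
  moreover have "sub (case_nat (ren r N) Var) (ren ?r M) = ren r (sub (case_nat N Var) M)"
    unfolding sub_ren ren_sub by (rule sub_cong) (auto split: nat.split)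
  ultimately show ?case by simp
qed (auto intro: ltyping.intros)

lemma ltyping_env_cong: "E \<tturnstile> M \<^bold>: \<rho> \<Longrightarrow> \<forall>v\<in>fv M. F v = E v \<Longrightarrow> F \<tturnstile> M \<^bold>: \<rho>"
  using ltyping_ren [of E M \<rho> F "\<lambda>i. i"] by (simp add: ren_id)

lemma ltyping_ren_iff:
  assumes "inj r" shows "F \<tturnstile> ren r M \<^bold>: \<rho> \<longleftrightarrow> (\<lambda>i. F (r i)) \<tturnstile> M \<^bold>: \<rho>"
proof
  assume "F \<tturnstile> ren r M \<^bold>: \<rho>"
  then have "(\<lambda>i. F (r i)) \<tturnstile> ren (inv r) (ren r M) \<^bold>: \<rho>"
    by (rule ltyping_ren) (use assms in \<open>auto simp: fv_ren inj_on_def\<close>)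
  then show "(\<lambda>i. F (r i)) \<tturnstile> M \<^bold>: \<rho>"
    using assms by (simp add: ren_ren ren_id)
next
  assume "(\<lambda>i. F (r i)) \<tturnstile> M \<^bold>: \<rho>"
  then show "F \<tturnstile> ren r M \<^bold>: \<rho>"
    by (rule ltyping_ren) (use assms in \<open>auto simp: inj_on_def\<close>)
qed

lemma ltyping_ren_Suc [simp]: "case_nat \<sigma> E \<tturnstile> ren Suc M \<^bold>: \<rho> \<longleftrightarrow> E \<tturnstile> M \<^bold>: \<rho>"
  by (simp add: ltyping_ren_iff)

lemma ltyping_sub:
  "F \<tturnstile> M \<^bold>: \<rho> \<Longrightarrow> \<forall>v\<in>fv M. E \<tturnstile> s v \<^bold>: F v \<Longrightarrow> disj s (fv M) \<Longrightarrow> E \<tturnstile> sub s M \<^bold>: \<rho>"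
proof (induction arbitrary: E s rule: ltyping.induct)
  case (ArrowI \<sigma> F M \<tau>)
  have "\<forall>v\<in>fv M. case_nat \<sigma> E \<tturnstile> up s v \<^bold>: case_nat \<sigma> F v"
    using ArrowI.prems(1) by (auto simp: up_def intro: ltyping.Ax split: nat.splits)
  moreover have "disj (up s) (fv M)"
    using ArrowI.prems(2) by (simp add: disj_up)
  ultimately have "case_nat \<sigma> E \<tturnstile> sub (up s) M \<^bold>: \<tau>"
    by (rule ArrowI.IH)
  then show ?case
    using ArrowI.hyps by (force simp: fv_sub intro!: ltyping.ArrowI)
next
  case (ArrowE F M \<sigma> \<tau> N)
  have "E \<tturnstile> sub s M \<^bold>: \<sigma> \<^bold>\<rightarrow> \<tau>" "E \<tturnstile> sub s N \<^bold>: \<sigma>"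
    using ArrowE.prems by (auto intro!: ArrowE.IH elim: disj_subset)
  moreover have "fv (sub s M) \<inter> fv (sub s N) = {}"
    using ArrowE.prems(2) ArrowE.hyps(3) by (simp add: disj_fv_sub)
  ultimately show ?case by (auto intro: ltyping.ArrowE)
next
  case (UnionE \<sigma> \<theta> F M \<rho> \<tau> N)
  have fv: "fv (sub (case_nat N Var) M) = fv N \<union> {i. Suc i \<in> fv M}"
    using UnionE.hyps by (auto simp: fv_scons)
  have disj: "disj (up s) (fv M)"
    using UnionE.prems(2) unfolding fv by (auto intro: disj_up elim: disj_subset)
  have typed: "\<forall>v\<in>fv M. case_nat \<alpha> E \<tturnstile> up s v \<^bold>: case_nat \<alpha> F v" for \<alpha>
    using UnionE.prems(1) unfolding fv by (auto simp: up_def intro: ltyping.Ax split: nat.splits)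
  have "E \<tturnstile> sub (case_nat (sub s N) Var) (sub (up s) M) \<^bold>: \<rho>"
  proof (rule ltyping.UnionE)
    show "case_nat (\<sigma> \<^bold>\<and> \<theta>) E \<tturnstile> sub (up s) M \<^bold>: \<rho>" "case_nat (\<tau> \<^bold>\<and> \<theta>) E \<tturnstile> sub (up s) M \<^bold>: \<rho>"
      by (rule UnionE.IH(1,2) [OF typed disj])+
    show "E \<tturnstile> sub s N \<^bold>: (\<sigma> \<^bold>\<or> \<tau>) \<^bold>\<and> \<theta>"
      by (rule UnionE.IH) (use UnionE.prems fv in \<open>auto elim: disj_subset\<close>)
    show "0 \<in> fv (sub (up s) M)" using UnionE.hyps by (force simp: fv_sub)
    show "\<forall>i. Suc i \<in> fv (sub (up s) M) \<longrightarrow> i \<notin> fv (sub s N)"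
    proof (intro allI impI notI)
      fix i assume "Suc i \<in> fv (sub (up s) M)" "i \<in> fv (sub s N)"
      then obtain j k where "Suc j \<in> fv M" "i \<in> fv (s j)" "k \<in> fv N" "i \<in> fv (s k)"
        by (auto simp: Suc_in_fv_sub_up fv_sub [of s N])
      with UnionE.prems(2) have "j = k" unfolding fv by (auto simp: disj_def)
      with \<open>Suc j \<in> fv M\<close> \<open>k \<in> fv N\<close> UnionE.hyps show False by auto
    qed
  qed
  then show ?case by (simp add: sub_up_beta sub_beta)
qed (auto intro: ltyping.intros)

text \<open>The substitution lemma for \<open>Var\<close>. Derivability of \<open>Var v\<close> at
  \<open>F v\<close> takes the place of a subtyping relation between environments.\<close>

lemma ltyping_strengthen:
  "F \<tturnstile> M \<^bold>: \<rho> \<Longrightarrow> \<forall>v\<in>fv M. E \<tturnstile> Var v \<^bold>: F v \<Longrightarrow> E \<tturnstile> M \<^bold>: \<rho>"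
  using ltyping_sub [of F M \<rho> E Var] by simp

text \<open>The left rule for unions: union elimination at the variable \<open>x\<close>. The rule
  asks for some \<open>\<theta>\<close>, and the union itself serves since \<open>x\<close> has that
  type anyway.\<close>

lemma ltyping_union_env:
  assumes 1: "E(x := \<sigma>) \<tturnstile> M \<^bold>: \<rho>" and 2: "E(x := \<tau>) \<tturnstile> M \<^bold>: \<rho>" and x: "E x = \<sigma> \<^bold>\<or> \<tau>"
  shows "E \<tturnstile> M \<^bold>: \<rho>"
proof (cases "x \<in> fv M")
  case False
  with 1 show ?thesis by (auto elim: ltyping_env_cong)
next
  case True
  \<comment> \<open>Index 0 is vacated for \<open>x\<close>, which the elimination rule then
    substitutes back.\<close>
  let ?r = "\<lambda>i. if i = x then 0 else Suc i"
  have inj: "inj_on ?r (fv M)" by (auto simp: inj_on_def)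
  have *: "case_nat (\<alpha> \<^bold>\<and> (\<sigma> \<^bold>\<or> \<tau>)) E \<tturnstile> ren ?r M \<^bold>: \<rho>" if "E(x := \<alpha>) \<tturnstile> M \<^bold>: \<rho>" for \<alpha>
  proof (rule ltyping_strengthen)
    show "case_nat \<alpha> E \<tturnstile> ren ?r M \<^bold>: \<rho>"
      by (rule ltyping_ren [OF that _ inj]) auto
    show "\<forall>v\<in>fv (ren ?r M). case_nat (\<alpha> \<^bold>\<and> (\<sigma> \<^bold>\<or> \<tau>)) E \<tturnstile> Var v \<^bold>: case_nat \<alpha> E v"
      by (auto intro: Ax InterE1 [where \<tau> = "\<sigma> \<^bold>\<or> \<tau>", OF Ax] split: nat.split)
  qed
  have "E \<tturnstile> sub (case_nat (Var x) Var) (ren ?r M) \<^bold>: \<rho>"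
  proof (rule UnionE [OF * [OF 1] * [OF 2]])
    show "E \<tturnstile> Var x \<^bold>: (\<sigma> \<^bold>\<or> \<tau>) \<^bold>\<and> (\<sigma> \<^bold>\<or> \<tau>)" using x by (auto intro: Ax InterI)
    show "0 \<in> fv (ren ?r M)" using True by (force simp: fv_ren)
    show "\<forall>i. Suc i \<in> fv (ren ?r M) \<longrightarrow> i \<notin> fv (Var x)" by (auto simp: fv_ren)
  qed
  also have "sub (case_nat (Var x) Var) (ren ?r M) = M"
    unfolding sub_ren by (rule sub_id) auto
  finally show ?thesis .
qed

section \<open>Overlapping substitutions\<close>

text \<open>The \<open>d\<close>-fold iterate of \<open>up\<close> in closed form.\<close>

definition upn :: "nat \<Rightarrow> (nat \<Rightarrow> tm) \<Rightarrow> nat \<Rightarrow> tm" where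
  "upn d s i = (if i < d then Var i else ren (\<lambda>j. j + d) (s (i - d)))"

lemma upn_0 [simp]: "upn 0 s = s"
  by (simp add: upn_def fun_eq_iff ren_id)

lemma up_upn: "up (upn d s) = upn (Suc d) s"
  by (auto simp: upn_def up_def fun_eq_iff ren_ren split: nat.split)

lemma ren_inject:
  assumes "inj r" "ren r M = ren r N" shows "M = N"
proof -
  have "ren (inv r) (ren r M) = ren (inv r) (ren r N)" using assms(2) by simp
  then show ?thesis using assms(1) by (simp add: ren_ren ren_id)
qed

lemma sub_upn_ren: "sub (upn d s) (ren (\<lambda>i. i + d) M) = ren (\<lambda>i. i + d) (sub s M)"
  by (simp add: sub_ren ren_sub upn_def)

text \<open>\<open>upn d s\<close> fixes the indices below \<open>d\<close>, and none of them is
  free in the right-hand side. Hence none is free in \<open>M\<close>, which can be lowered by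
  \<open>d\<close>.\<close>

lemma sub_upn_eq_renD:
  assumes eq: "sub (upn d s) M = ren (\<lambda>i. i + d) N"
  obtains M' where "M = ren (\<lambda>i. i + d) M'" "sub s M' = N"
proof
  have ge: "d \<le> i" if "i \<in> fv M" for i
  proof (rule ccontr)
    assume "\<not> d \<le> i"
    then have "i \<in> fv (sub (upn d s) M)" using that by (force simp: fv_sub upn_def)
    with \<open>\<not> d \<le> i\<close> show False by (auto simp: eq fv_ren)
  qed
  show M: "M = ren (\<lambda>i. i + d) (ren (\<lambda>i. i - d) M)"
    unfolding ren_ren using ge by (simp add: ren_id)
  have "ren (\<lambda>i. i + d) (sub s (ren (\<lambda>i. i - d) M)) = ren (\<lambda>i. i + d) N"
    using eq M sub_upn_ren by metis
  then show "sub s (ren (\<lambda>i. i - d) M) = N"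
    by (rule ren_inject [rotated]) (simp add: inj_def)
qed

text \<open>
  Two ways in which one term can be read both as \<open>K\<close> with \<open>N\<close> in its hole \<open>d\<close> and as \<open>B\<close>
  instantiated by \<open>s\<close>, under \<open>d\<close> binders: either \<open>N\<close> is itself an instance \<open>sub s B'\<close> of a subterm of
  \<open>B\<close>, or \<open>N\<close> is a subterm of the term substituted for a single variable \<open>v\<close> of \<open>B\<close>.
\<close>

definition overlap_inner :: "(nat \<Rightarrow> tm) \<Rightarrow> tm \<Rightarrow> nat \<Rightarrow> tm \<Rightarrow> tm \<Rightarrow> bool" where
  "overlap_inner s N d K B \<longleftrightarrow> (\<exists>B' K'. B = sub (upn d (case_nat B' Var)) K' \<and>
    K = sub (upn d (up s)) K' \<and> N = sub s B' \<and> d \<in> fv K' \<and> lin K' \<and> lin B' \<and>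
    (\<forall>i. Suc (i + d) \<in> fv K' \<longrightarrow> i \<notin> fv B'))"

definition overlap_outer :: "(nat \<Rightarrow> tm) \<Rightarrow> tm \<Rightarrow> nat \<Rightarrow> tm \<Rightarrow> tm \<Rightarrow> bool" where
  "overlap_outer s N d K B \<longleftrightarrow> (\<exists>v A. v + d \<in> fv B \<and> s v = sub (case_nat N Var) A \<and>
    K = sub (upn d ((\<lambda>u. ren Suc (s u))(v := A))) B)"

text \<open>This treats the parts of the term off the path to the hole. They fit into either kind of
  overlap, and the equations provide the form required by each.\<close>

lemma overlap_disjoint:
  assumes eq: "sub (upn d (case_nat N Var)) K = sub (upn d s) B" and d: "d \<notin> fv K"
  defines "q \<equiv> (\<lambda>i. if i < d then i else Suc i)"
  shows "K = sub (upn d (\<lambda>u. ren Suc (s u))) B" "K = sub (upn d (up s)) (ren q B)"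
    "B = sub (upn d (case_nat B' Var)) (ren q B)"
proof -
  \<comment> \<open>Filling an absent hole only closes the gap at \<open>d\<close>, and
    \<open>q\<close> opens it again.\<close>
  have "K = ren q (sub (upn d (case_nat N Var)) K)"
    unfolding ren_sub by (rule sub_id [symmetric])
      (use d in \<open>force simp: upn_def q_def split: nat.split\<close>)
  then have "K = ren q (sub (upn d s) B)" by (simp add: eq)
  also have "\<dots> = sub (upn d (\<lambda>u. ren Suc (s u))) B"
    unfolding ren_sub by (rule sub_cong) (auto simp: upn_def q_def ren_ren intro: ren_cong)
  finally show K: "K = sub (upn d (\<lambda>u. ren Suc (s u))) B" .
  show "K = sub (upn d (up s)) (ren q B)"
    unfolding K sub_ren by (rule sub_cong) (auto simp: upn_def q_def Suc_diff_le)
  show "B = sub (upn d (case_nat B' Var)) (ren q B)"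
    unfolding sub_ren by (rule sub_id [symmetric]) (auto simp: upn_def q_def Suc_diff_le)
qed

lemma fv_overlap_inner:
  assumes B: "B = sub (upn d (case_nat B' Var)) K'" and "d \<in> fv K'"
  shows "fv K' \<subseteq> insert d ((\<lambda>i. if i < d then i else Suc i) ` fv B)" "(\<lambda>i. i + d) ` fv B' \<subseteq> fv B"
proof -
  have *: "(if i < d then i else i - 1) \<in> fv B" if "i \<in> fv K'" "i \<noteq> d" for i
    unfolding B fv_sub
    by (rule UN_I [OF that(1)]) (use that(2) in \<open>auto simp: upn_def split: nat.split\<close>)
  show "fv K' \<subseteq> insert d ((\<lambda>i. if i < d then i else Suc i) ` fv B)"
  proof
    fix i assume "i \<in> fv K'"
    then show "i \<in> insert d ((\<lambda>i. if i < d then i else Suc i) ` fv B)"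
      using * [of i]
      by (cases "i = d") (auto simp: image_iff split: if_splits intro!: bexI [of _ "if i < d then i else i - 1"])
  qed
  show "(\<lambda>i. i + d) ` fv B' \<subseteq> fv B"
    using assms(2) unfolding B fv_sub by (force simp: upn_def fv_ren)
qed

text \<open>By linearity the hole lies in one part of an application only: \<open>K\<close> and
  \<open>B\<close> are the part with the hole, \<open>L\<close> and \<open>C\<close> the part
  without. Both orders are treated together.\<close>

lemma overlap_App:
  assumes "overlap_inner s N d K B \<or> overlap_outer s N d K B"
    and eq: "sub (upn d (case_nat N Var)) L = sub (upn d s) C" and d: "d \<notin> fv L"
    and lin: "lin (App B C)"
  shows "overlap_inner s N d (App K L) (App B C) \<and> overlap_inner s N d (App L K) (App C B) \<or>
    overlap_outer s N d (App K L) (App B C) \<and> overlap_outer s N d (App L K) (App C B)"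
  using assms(1)
proof
  assume "overlap_inner s N d K B"
  then obtain B' K' where *: "B = sub (upn d (case_nat B' Var)) K'" "K = sub (upn d (up s)) K'"
    "N = sub s B'" "d \<in> fv K'" "lin K'" "lin B'" "\<forall>i. Suc (i + d) \<in> fv K' \<longrightarrow> i \<notin> fv B'"
    unfolding overlap_inner_def by blast
  define q where "q = (\<lambda>i. if i < d then i else Suc i)"
  have q: "inj q" "d \<notin> range q" by (auto simp: q_def inj_def split: if_splits)
  note side = overlap_disjoint(2) [OF eq d, folded q_def] overlap_disjoint(3) [OF eq d, where B' = B', folded q_def]
  have sub: "fv K' \<subseteq> insert d (q ` fv B)" "(\<lambda>i. i + d) ` fv B' \<subseteq> fv B"
    using fv_overlap_inner [OF *(1,4)] by (auto simp: q_def)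
  have disj: "fv K' \<inter> fv (ren q C) = {}"
  proof -
    have "q ` fv B \<inter> q ` fv C = {}" using lin q(1) by (auto dest: injD)
    then show ?thesis using sub(1) q(2) unfolding fv_ren by blast
  qed
  have no: "i \<notin> fv B'" if "Suc (i + d) \<in> fv (ren q C)" for i
  proof -
    have "i + d \<in> fv C" using that by (auto simp: fv_ren q_def split: if_splits)
    then show ?thesis using lin sub(2) by auto
  qed
  have "lin (ren q C)" using lin q(1) by (simp add: lin_ren inj_on_subset)
  then have lin': "lin (App K' (ren q C))" "lin (App (ren q C) K')"
    using disj \<open>lin K'\<close> by auto
  have "overlap_inner s N d (App K L) (App B C)"
    unfolding overlap_inner_def
    by (intro exI [of _ B'] exI [of _ "App K' (ren q C)"] conjI lin') (use * side no in auto)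
  moreover have "overlap_inner s N d (App L K) (App C B)"
    unfolding overlap_inner_def
    by (intro exI [of _ B'] exI [of _ "App (ren q C) K'"] conjI lin') (use * side no in auto)
  ultimately have "overlap_inner s N d (App K L) (App B C) \<and> overlap_inner s N d (App L K) (App C B)" ..
  then show ?thesis by blast
next
  assume "overlap_outer s N d K B"
  then obtain v A where *: "v + d \<in> fv B" "s v = sub (case_nat N Var) A"
    "K = sub (upn d ((\<lambda>u. ren Suc (s u))(v := A))) B"
    unfolding overlap_outer_def by blast
  \<comment> \<open>Linearity keeps \<open>v + d\<close> out of \<open>C\<close>, so changing the
    substitution at \<open>v\<close> does not affect this part.\<close>
  have "L = sub (upn d ((\<lambda>u. ren Suc (s u))(v := A))) C"
    unfolding overlap_disjoint(1) [OF eq d]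
    by (rule sub_cong) (use *(1) lin in \<open>auto simp: upn_def\<close>)
  then have "overlap_outer s N d (App K L) (App B C) \<and> overlap_outer s N d (App L K) (App C B)"
    unfolding overlap_outer_def using * by auto
  then show ?thesis by blast
qed

text \<open>A variable below \<open>d\<close> cannot come from the hole, whose content is shifted by
  \<open>d\<close>. Any other variable of \<open>B\<close> covers the whole of
  \<open>K\<close>.\<close>

lemma overlap_Var:
  assumes eq: "sub (upn d (case_nat N Var)) K = sub (upn d s) (Var j)" and d: "d \<in> fv K"
  shows "overlap_inner s N d K (Var j) \<or> overlap_outer s N d K (Var j)"
proof (cases "j < d")
  case True
  with eq have "sub (upn d (case_nat N Var)) K = Var j" by (simp add: upn_def)
  with d True show ?thesis by (cases K) (auto simp: upn_def elim: ren.elims)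
next
  case False
  then have "sub (upn d (case_nat N Var)) K = ren (\<lambda>i. i + d) (s (j - d))"
    using eq by (simp add: upn_def)
  then obtain A where "K = ren (\<lambda>i. i + d) A" "sub (case_nat N Var) A = s (j - d)"
    by (rule sub_upn_eq_renD)
  with False have "overlap_outer s N d K (Var j)"
    unfolding overlap_outer_def by (intro exI [of _ "j - d"] exI [of _ A]) (simp add: upn_def)
  then show ?thesis ..
qed

text \<open>Both readings are followed downwards in parallel, always into the part with the hole.
  The descent ends at the hole, an inner overlap with context \<open>Var d\<close>, or at a variable
  of \<open>B\<close>, an outer overlap.\<close>

lemma overlap:
  "sub (upn d (case_nat N Var)) K = sub (upn d s) B \<Longrightarrow> d \<in> fv K \<Longrightarrow> lin K \<Longrightarrow> lin B \<Longrightarrow>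
    overlap_inner s N d K B \<or> overlap_outer s N d K B"
proof (induction K arbitrary: B d)
  case (Var i)
  moreover have "upn d (case_nat N Var) d = ren (\<lambda>j. j + d) N" by (simp add: upn_def)
  ultimately have "sub (upn d s) B = ren (\<lambda>j. j + d) N" by simp
  then obtain B' where B': "B = ren (\<lambda>i. i + d) B'" "sub s B' = N"
    by (rule sub_upn_eq_renD)
  have "lin B'"
  proof -
    have "B' = ren (\<lambda>i. i - d) B" unfolding B' ren_ren by (simp add: ren_id)
    moreover have "inj_on (\<lambda>i. i - d) (fv B)" by (auto simp: B' fv_ren inj_on_def)
    ultimately show ?thesis using Var.prems(4) by (simp add: lin_ren)
  qed
  then have "overlap_inner s N d (Var i) B"
    unfolding overlap_inner_def using B' Var
    by (intro exI [of _ B'] exI [of _ "Var d"]) (simp add: upn_def)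
  then show ?case ..
next
  case K: (App K L)
  show ?case
  proof (cases B)
    case (Var j)
    then show ?thesis using K.prems overlap_Var by blast
  next
    case B: (App C D)
    have eqs: "sub (upn d (case_nat N Var)) K = sub (upn d s) C"
      "sub (upn d (case_nat N Var)) L = sub (upn d s) D"
      using K.prems(1) B by auto
    show ?thesis
    proof (cases "d \<in> fv K")
      case True
      then have "d \<notin> fv L" using K.prems by auto
      have "overlap_inner s N d K C \<or> overlap_outer s N d K C"
        by (rule K.IH(1)) (use True K.prems B in auto)
      from overlap_App [OF this eqs(2) \<open>d \<notin> fv L\<close>] K.prems show ?thesis
        by (auto simp: B)
    next
      case False
      have "overlap_inner s N d L D \<or> overlap_outer s N d L D"
        by (rule K.IH(2)) (use False K.prems B in auto)
      from overlap_App [OF this eqs(1) False] K.prems show ?thesis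
        by (auto simp: B)
    qed
  qed (use K.prems in simp)
next
  case K: (Lam K)
  show ?case
  proof (cases B)
    case (Var j)
    then show ?thesis using K.prems overlap_Var by blast
  next
    case B: (Lam C)
    have "overlap_inner s N (Suc d) K C \<or> overlap_outer s N (Suc d) K C"
      by (rule K.IH) (use K.prems in \<open>auto simp: up_upn B\<close>)
    then show ?thesis
    proof
      assume "overlap_inner s N (Suc d) K C"
      then obtain B' K' where *: "C = sub (upn (Suc d) (case_nat B' Var)) K'"
        "K = sub (upn (Suc d) (up s)) K'" "N = sub s B'" "Suc d \<in> fv K'" "lin K'" "lin B'"
        "\<forall>i. Suc (i + Suc d) \<in> fv K' \<longrightarrow> i \<notin> fv B'"
        unfolding overlap_inner_def by blast
      \<comment> \<open>Needed for \<open>Lam K'\<close> to be linear: a substitution under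
        \<open>Suc d\<close> binders fixes index 0 and creates no further occurrence of it.\<close>
      have "0 \<in> fv K'"
        using K.prems(3) by (auto simp: *(2) fv_sub upn_def fv_ren split: if_splits)
      with * have "overlap_inner s N d (Lam K) B"
        unfolding overlap_inner_def B
        by (intro exI [of _ B'] exI [of _ "Lam K'"]) (simp add: up_upn)
      then show ?thesis ..
    next
      assume "overlap_outer s N (Suc d) K C"
      then have "overlap_outer s N d (Lam K) B"
        unfolding overlap_outer_def B by (auto simp: up_upn)
      then show ?thesis ..
    qed
  qed (use K.prems in simp)
qed

section \<open>Decomposition of substituted terms and weak head expansion\<close>

text \<open>
  When a union elimination is performed inside the term substituted for \<open>v\<close>, the union of the two
  types found for \<open>v\<close> serves as its type. Linearity is essential: a variable occurring once is
  replaced as a whole.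
\<close>

lemma ltyping_decompose:
  "E \<tturnstile> M \<^bold>: \<rho> \<Longrightarrow> M = sub s B \<Longrightarrow> lin B \<Longrightarrow>
    \<exists>F. F \<tturnstile> B \<^bold>: \<rho> \<and> (\<forall>v\<in>fv B. E \<tturnstile> s v \<^bold>: F v)"
proof (induction arbitrary: s B rule: ltyping.induct)
  case (Ax E x \<sigma>)
  then obtain v where "B = Var v" "s v = Var x" by (cases B) auto
  with Ax show ?case by (intro exI [of _ "\<lambda>_. \<sigma>"]) (auto intro: ltyping.Ax)
next
  case (ArrowI \<sigma> E M \<tau>)
  show ?case
  proof (cases B)
    \<comment> \<open>If \<open>B\<close> is a variable, the whole of \<open>M\<close> was
      substituted for it, and the type of \<open>M\<close> is the type sought.\<close>
    case (Var v)
    with ltyping.ArrowI [OF ArrowI.hyps] ArrowI.prems show ?thesis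
      by (intro exI [of _ "\<lambda>_. \<sigma> \<^bold>\<rightarrow> \<tau>"]) (auto intro: ltyping.Ax)
  next
    case B: (Lam C)
    with ArrowI obtain F where F: "F \<tturnstile> C \<^bold>: \<tau>" "\<forall>v\<in>fv C. case_nat \<sigma> E \<tturnstile> up s v \<^bold>: F v"
      by force
    \<comment> \<open>\<open>F 0\<close> is just some type that index 0 has by virtue of
      \<open>\<sigma>\<close>; the abstraction needs \<open>\<sigma>\<close> itself.\<close>
    let ?F = "case_nat \<sigma> (\<lambda>i. F (Suc i))"
    have "?F \<tturnstile> C \<^bold>: \<tau>"
    proof (rule ltyping_strengthen [OF F(1)], rule ballI)
      fix v assume v: "v \<in> fv C"
      show "?F \<tturnstile> Var v \<^bold>: F v"
      proof (cases v)
        case 0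
        with F(2) v have "case_nat \<sigma> E \<tturnstile> Var v \<^bold>: F v" by force
        then show ?thesis by (rule ltyping_env_cong) (simp add: 0)
      qed (auto intro: ltyping.Ax)
    qed
    then show ?thesis
      using F(2) ArrowI.prems(2) B
      by (intro exI [of _ "\<lambda>i. F (Suc i)"]) (fastforce intro: ltyping.ArrowI)
  qed (use ArrowI.prems in simp)
next
  case (ArrowE E M \<sigma> \<tau> N)
  show ?case
  proof (cases B)
    case (Var v)
    with ltyping.ArrowE [OF ArrowE.hyps] ArrowE.prems show ?thesis
      by (intro exI [of _ "\<lambda>_. \<tau>"]) (auto intro: ltyping.Ax)
  next
    case B: (App C D)
    have "M = sub s C" "N = sub s D" "lin C" "lin D" using ArrowE.prems B by auto
    with ArrowE.IH obtain F G
      where F: "F \<tturnstile> C \<^bold>: \<sigma> \<^bold>\<rightarrow> \<tau>" "\<forall>v\<in>fv C. E \<tturnstile> s v \<^bold>: F v"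
        and G: "G \<tturnstile> D \<^bold>: \<sigma>" "\<forall>v\<in>fv D. E \<tturnstile> s v \<^bold>: G v"
      by metis
    let ?F = "\<lambda>v. if v \<in> fv C then F v else G v"
    have dis: "fv C \<inter> fv D = {}" using ArrowE.prems B by simp
    have "?F \<tturnstile> C \<^bold>: \<sigma> \<^bold>\<rightarrow> \<tau>" by (rule ltyping_env_cong [OF F(1)]) simp
    moreover have "?F \<tturnstile> D \<^bold>: \<sigma>" by (rule ltyping_env_cong [OF G(1)]) (use dis in auto)
    ultimately have "?F \<tturnstile> B \<^bold>: \<tau>" unfolding B using dis by (rule ltyping.ArrowE)
    moreover have "\<forall>v\<in>fv B. E \<tturnstile> s v \<^bold>: ?F v" using F(2) G(2) by (auto simp: B)
    ultimately show ?thesis by blast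
  qed (use ArrowE.prems in simp)
next
  case (InterI E M \<sigma> \<tau>)
  then obtain F G where F: "F \<tturnstile> B \<^bold>: \<sigma>" "\<forall>v\<in>fv B. E \<tturnstile> s v \<^bold>: F v"
    and G: "G \<tturnstile> B \<^bold>: \<tau>" "\<forall>v\<in>fv B. E \<tturnstile> s v \<^bold>: G v"
    by metis
  \<comment> \<open>The two premises may find different types for the same variable.\<close>
  let ?F = "\<lambda>v. F v \<^bold>\<and> G v"
  have "?F \<tturnstile> B \<^bold>: \<sigma>"
    by (rule ltyping_strengthen [OF F(1)]) (blast intro: ltyping.InterE1 ltyping.Ax)
  moreover have "?F \<tturnstile> B \<^bold>: \<tau>"
    by (rule ltyping_strengthen [OF G(1)]) (blast intro: ltyping.InterE2 ltyping.Ax)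
  ultimately show ?case
    using F(2) G(2) by (blast intro: ltyping.InterI)
next
  case (UnionE \<sigma> \<theta> E M \<rho> \<tau> N)
  have "sub (upn 0 (case_nat N Var)) M = sub (upn 0 s) B" using UnionE.prems by simp
  moreover have "lin M" by (rule ltyping_lin [OF UnionE.hyps(1)])
  ultimately have "overlap_inner s N 0 M B \<or> overlap_outer s N 0 M B"
    using UnionE by (intro overlap) auto
  then show ?case
  proof
    assume "overlap_inner s N 0 M B"
    then obtain B' K where *: "B = sub (case_nat B' Var) K" "M = sub (up s) K" "N = sub s B'"
      "0 \<in> fv K" "lin K" "lin B'" "\<forall>i. Suc i \<in> fv K \<longrightarrow> i \<notin> fv B'"
      unfolding overlap_inner_def by auto
    from UnionE.IH(1) [OF *(2,5)] obtain F where
      F: "F \<tturnstile> K \<^bold>: \<rho>" "\<forall>v\<in>fv K. case_nat (\<sigma> \<^bold>\<and> \<theta>) E \<tturnstile> up s v \<^bold>: F v" by blast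
    from UnionE.IH(2) [OF *(2,5)] obtain G where
      G: "G \<tturnstile> K \<^bold>: \<rho>" "\<forall>v\<in>fv K. case_nat (\<tau> \<^bold>\<and> \<theta>) E \<tturnstile> up s v \<^bold>: G v" by blast
    from UnionE.IH(3) [OF *(3,6)] obtain H where
      H: "H \<tturnstile> B' \<^bold>: (\<sigma> \<^bold>\<or> \<tau>) \<^bold>\<and> \<theta>" "\<forall>v\<in>fv B'. E \<tturnstile> s v \<^bold>: H v" by blast
    \<comment> \<open>Variables of \<open>B'\<close> are typed by the derivation of the union, the
      others by both branches of the elimination.\<close>
    let ?F = "\<lambda>u. if u \<in> fv B' then H u else F (Suc u) \<^bold>\<and> G (Suc u)"
    have "?F \<tturnstile> sub (case_nat B' Var) K \<^bold>: \<rho>"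
    proof (rule ltyping.UnionE)
      show "case_nat (\<sigma> \<^bold>\<and> \<theta>) ?F \<tturnstile> K \<^bold>: \<rho>"
      proof (rule ltyping_strengthen [OF F(1)], rule ballI)
        fix v assume v: "v \<in> fv K"
        show "case_nat (\<sigma> \<^bold>\<and> \<theta>) ?F \<tturnstile> Var v \<^bold>: F v"
        proof (cases v)
          case 0
          with F(2) v have "case_nat (\<sigma> \<^bold>\<and> \<theta>) E \<tturnstile> Var v \<^bold>: F v" by force
          then show ?thesis by (rule ltyping_env_cong) (simp add: 0)
        next
          case (Suc u)
          then have "case_nat (\<sigma> \<^bold>\<and> \<theta>) ?F v = F v \<^bold>\<and> G v" using *(7) v by auto
          then show ?thesis by (blast intro: ltyping.InterE1 ltyping.Ax)
        qed
      qed
      show "case_nat (\<tau> \<^bold>\<and> \<theta>) ?F \<tturnstile> K \<^bold>: \<rho>"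
      proof (rule ltyping_strengthen [OF G(1)], rule ballI)
        fix v assume v: "v \<in> fv K"
        show "case_nat (\<tau> \<^bold>\<and> \<theta>) ?F \<tturnstile> Var v \<^bold>: G v"
        proof (cases v)
          case 0
          with G(2) v have "case_nat (\<tau> \<^bold>\<and> \<theta>) E \<tturnstile> Var v \<^bold>: G v" by force
          then show ?thesis by (rule ltyping_env_cong) (simp add: 0)
        next
          case (Suc u)
          then have "case_nat (\<tau> \<^bold>\<and> \<theta>) ?F v = F v \<^bold>\<and> G v" using *(7) v by auto
          then show ?thesis by (blast intro: ltyping.InterE2 ltyping.Ax)
        qed
      qed
      show "?F \<tturnstile> B' \<^bold>: (\<sigma> \<^bold>\<or> \<tau>) \<^bold>\<and> \<theta>"
        by (rule ltyping_env_cong [OF H(1)]) simp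
    qed (fact *)+
    moreover have "E \<tturnstile> s v \<^bold>: ?F v" if "v \<in> fv B" for v
    proof (cases "v \<in> fv B'")
      case False
      with that *(1,4) have "Suc v \<in> fv K" by (auto simp: fv_scons)
      with F(2) G(2) have "E \<tturnstile> s v \<^bold>: F (Suc v)" "E \<tturnstile> s v \<^bold>: G (Suc v)" by fastforce+
      with False show ?thesis by (auto intro: ltyping.InterI)
    qed (use H(2) in simp)
    ultimately show ?thesis using *(1) by blast
  next
    assume "overlap_outer s N 0 M B"
    then obtain v A where v: "v \<in> fv B" and A: "s v = sub (case_nat N Var) A"
      and M: "M = sub ((\<lambda>u. ren Suc (s u))(v := A)) B"
      unfolding overlap_outer_def by auto
    let ?s = "(\<lambda>u. ren Suc (s u))(v := A)"
    from UnionE.IH(1) [OF M UnionE.prems(2)] obtain F where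
      F: "F \<tturnstile> B \<^bold>: \<rho>" "\<forall>u\<in>fv B. case_nat (\<sigma> \<^bold>\<and> \<theta>) E \<tturnstile> ?s u \<^bold>: F u" by blast
    from UnionE.IH(2) [OF M UnionE.prems(2)] obtain G where
      G: "G \<tturnstile> B \<^bold>: \<rho>" "\<forall>u\<in>fv B. case_nat (\<tau> \<^bold>\<and> \<theta>) E \<tturnstile> ?s u \<^bold>: G u" by blast
    \<comment> \<open>The hypothesis being eliminated occurs only in the term for \<open>v\<close>,
      so every other variable has both types in \<open>E\<close>.\<close>
    let ?F = "\<lambda>u. if u = v then F u \<^bold>\<or> G u else F u \<^bold>\<and> G u"
    have "?F \<tturnstile> B \<^bold>: \<rho>"
    proof (rule ltyping_union_env)
      show "?F(v := F v) \<tturnstile> B \<^bold>: \<rho>"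
      proof (rule ltyping_strengthen [OF F(1)], rule ballI)
        show "?F(v := F v) \<tturnstile> Var u \<^bold>: F u" for u
          by (cases "u = v")
            (simp_all add: ltyping.Ax ltyping.InterE1 [where \<tau> = "G u", OF ltyping.Ax])
      qed
      show "?F(v := G v) \<tturnstile> B \<^bold>: \<rho>"
      proof (rule ltyping_strengthen [OF G(1)], rule ballI)
        show "?F(v := G v) \<tturnstile> Var u \<^bold>: G u" for u
          by (cases "u = v")
            (simp_all add: ltyping.Ax ltyping.InterE2 [where \<sigma> = "F u", OF ltyping.Ax])
      qed
    qed simp
    moreover have "E \<tturnstile> s u \<^bold>: ?F u" if u: "u \<in> fv B" for u
    proof (cases "u = v")
      case True
      have "E \<tturnstile> sub (case_nat N Var) A \<^bold>: F v \<^bold>\<or> G v"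
      proof (rule ltyping.UnionE)
        show "case_nat (\<sigma> \<^bold>\<and> \<theta>) E \<tturnstile> A \<^bold>: F v \<^bold>\<or> G v"
          by (rule ltyping.UnionI1) (use F(2) v in force)
        show "case_nat (\<tau> \<^bold>\<and> \<theta>) E \<tturnstile> A \<^bold>: F v \<^bold>\<or> G v"
          by (rule ltyping.UnionI2) (use G(2) v in force)
        have "fv A \<subseteq> fv M" using v unfolding M fv_sub by auto
        then show "\<forall>i. Suc i \<in> fv A \<longrightarrow> i \<notin> fv N" using UnionE.hyps by blast
        show "0 \<in> fv A"
          using \<open>0 \<in> fv M\<close> unfolding M fv_sub by (auto simp: fv_ren split: if_splits)
      qed (rule UnionE.hyps)
      with True A show ?thesis by simp
    next
      case False
      with F(2) G(2) u have "E \<tturnstile> s u \<^bold>: F u" "E \<tturnstile> s u \<^bold>: G u" by fastforce+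
      with False show ?thesis by (auto intro: ltyping.InterI)
    qed
    ultimately show ?thesis by blast
  qed
qed (blast intro: ltyping.intros)+

inductive whr :: "tm \<Rightarrow> tm \<Rightarrow> bool" where
  "whr (App (Lam M) N) (sub (case_nat N Var) M)"
| "whr M M' \<Longrightarrow> whr (App M N) (App M' N)"

text \<open>
  Expansion fails under binders: for \<open>a : \<gamma>\<close> and \<open>g : \<gamma> \<rightarrow> \<sigma> \<or> \<tau>\<close>, the term \<open>\<lambda>v. v (g a)\<close> has the type
  \<open>((\<sigma> \<rightarrow> \<rho>) \<rightarrow> \<rho>) \<or> ((\<tau> \<rightarrow> \<rho>) \<rightarrow> \<rho>)\<close>, but in \<open>\<lambda>v. (\<lambda>u. v (g u)) a\<close> the argument \<open>g u\<close> of union type mentions a bound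
  variable and cannot be eliminated outside \<open>\<lambda>v\<close>.
\<close>

lemma whr_ltyping: "whr M M' \<Longrightarrow> lin M \<Longrightarrow> E \<tturnstile> M' \<^bold>: \<rho> \<Longrightarrow> E \<tturnstile> M \<^bold>: \<rho>"
proof (induction arbitrary: \<rho> rule: whr.induct)
  case (1 M N)
  then have M: "lin M" "0 \<in> fv M" and dis: "fv (Lam M) \<inter> fv N = {}" by auto
  from ltyping_decompose [OF 1(2) refl M(1)] obtain F
    where F: "F \<tturnstile> M \<^bold>: \<rho>" "\<forall>v\<in>fv M. E \<tturnstile> case_nat N Var v \<^bold>: F v" by blast
  \<comment> \<open>The type found for \<open>N\<close> becomes the argument type of the
    abstraction; the other variables were replaced by themselves.\<close>
  have "case_nat (F 0) E \<tturnstile> M \<^bold>: \<rho>"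
  proof (rule ltyping_strengthen [OF F(1)], rule ballI)
    fix v assume v: "v \<in> fv M"
    show "case_nat (F 0) E \<tturnstile> Var v \<^bold>: F v"
    proof (cases v)
      case (Suc u)
      with F(2) v have "E \<tturnstile> Var u \<^bold>: F v" by force
      then have "case_nat (F 0) E \<tturnstile> ren Suc (Var u) \<^bold>: F v" by (simp only: ltyping_ren_Suc)
      with Suc show ?thesis by simp
    qed (auto intro: Ax)
  qed
  then have "E \<tturnstile> Lam M \<^bold>: F 0 \<^bold>\<rightarrow> \<rho>" using M(2) by (rule ArrowI)
  moreover have "E \<tturnstile> N \<^bold>: F 0" using F(2) M(2) by force
  ultimately show ?case using dis by (rule ArrowE)
next
  case (2 M M' N)
  \<comment> \<open>Reading the application as an instance of a two-variable template isolates a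
    type of \<open>M'\<close> to which the induction hypothesis applies.\<close>
  let ?s = "case_nat M' (\<lambda>_. N)" and ?t = "case_nat M (\<lambda>_. N)"
  have "E \<tturnstile> sub ?s (App (Var 0) (Var 1)) \<^bold>: \<rho>" using 2 by simp
  from ltyping_decompose [OF this refl] obtain F
    where F: "F \<tturnstile> App (Var 0) (Var 1) \<^bold>: \<rho>" "E \<tturnstile> M' \<^bold>: F 0" "E \<tturnstile> N \<^bold>: F 1" by auto
  have "E \<tturnstile> sub ?t (App (Var 0) (Var 1)) \<^bold>: \<rho>"
    by (rule ltyping_sub [OF F(1)]) (use F(2,3) 2 in \<open>auto simp: disj_def\<close>)
  then show ?case by simp
qed

section \<open>Equivalence with the given type system\<close>

text \<open>Quantifying over all total extensions lets both halves of a split environment be used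
  with the same \<open>E\<close>.\<close>

lemma typing_ltyping:
  "\<Gamma> \<turnstile> M \<^bold>: \<rho> \<Longrightarrow> dom \<Gamma> = fv M \<and> (\<forall>E. (\<forall>x \<sigma>. \<Gamma> x = Some \<sigma> \<longrightarrow> E x = \<sigma>) \<longrightarrow> E \<tturnstile> M \<^bold>: \<rho>)"
proof (induction rule: typing.induct)
  case (ArrowI \<sigma> \<Gamma> M \<tau>)
  then have dom: "dom (extend \<sigma> \<Gamma>) = fv M" by blast
  then have "0 \<in> fv M" by (auto simp: extend_def)
  moreover have "dom \<Gamma> = {i. Suc i \<in> fv M}"
    unfolding dom [symmetric] by (auto simp: extend_def)
  moreover have "case_nat \<sigma> E \<tturnstile> M \<^bold>: \<tau>" if "\<forall>x \<sigma>. \<Gamma> x = Some \<sigma> \<longrightarrow> E x = \<sigma>" for E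
    using ArrowI that by (auto simp: extend_def split: nat.split)
  ultimately show ?case by (auto intro: ltyping.ArrowI)
next
  case (ArrowE \<Gamma>\<^sub>1 M \<sigma> \<tau> \<Gamma>\<^sub>2 N)
  have "E \<tturnstile> App M N \<^bold>: \<tau>" if E: "\<forall>x \<sigma>. (\<Gamma>\<^sub>1 ++ \<Gamma>\<^sub>2) x = Some \<sigma> \<longrightarrow> E x = \<sigma>" for E
  proof -
    have "\<forall>x \<sigma>. \<Gamma>\<^sub>1 x = Some \<sigma> \<longrightarrow> E x = \<sigma>" "\<forall>x \<sigma>. \<Gamma>\<^sub>2 x = Some \<sigma> \<longrightarrow> E x = \<sigma>"
      using E ArrowE.hyps(3) by (metis disjoint_iff domI map_add_comm map_add_find_right)+
    then have "E \<tturnstile> M \<^bold>: \<sigma> \<^bold>\<rightarrow> \<tau>" "E \<tturnstile> N \<^bold>: \<sigma>" using ArrowE.IH by blast+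
    then show ?thesis using ArrowE by (auto intro: ltyping.ArrowE)
  qed
  then show ?case using ArrowE by auto
next
  case (UnionE \<sigma> \<theta> \<Gamma>\<^sub>1 M \<rho> \<tau> \<Gamma>\<^sub>2 N)
  then have dom: "dom (extend (\<sigma> \<^bold>\<and> \<theta>) \<Gamma>\<^sub>1) = fv M" by blast
  then have 0: "0 \<in> fv M" by (auto simp: extend_def)
  have dom1: "dom \<Gamma>\<^sub>1 = {i. Suc i \<in> fv M}"
    unfolding dom [symmetric] by (auto simp: extend_def)
  have "E \<tturnstile> M\<^bold>[N\<^bold>/0\<^bold>] \<^bold>: \<rho>" if E: "\<forall>x \<sigma>. (\<Gamma>\<^sub>1 ++ \<Gamma>\<^sub>2) x = Some \<sigma> \<longrightarrow> E x = \<sigma>" for E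
    unfolding subst_0
  proof (rule ltyping.UnionE)
    have *: "\<forall>x \<sigma>. \<Gamma>\<^sub>1 x = Some \<sigma> \<longrightarrow> E x = \<sigma>" "\<forall>x \<sigma>. \<Gamma>\<^sub>2 x = Some \<sigma> \<longrightarrow> E x = \<sigma>"
      using E UnionE.hyps(4) by (metis disjoint_iff domI map_add_comm map_add_find_right)+
    show "case_nat (\<sigma> \<^bold>\<and> \<theta>) E \<tturnstile> M \<^bold>: \<rho>" "case_nat (\<tau> \<^bold>\<and> \<theta>) E \<tturnstile> M \<^bold>: \<rho>"
      using UnionE.IH(1,2) * by (auto simp: extend_def split: nat.split)
    show "E \<tturnstile> N \<^bold>: (\<sigma> \<^bold>\<or> \<tau>) \<^bold>\<and> \<theta>" using UnionE.IH(3) * by blast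
    show "\<forall>i. Suc i \<in> fv M \<longrightarrow> i \<notin> fv N" using dom1 UnionE by blast
  qed (fact 0)
  moreover have "dom (\<Gamma>\<^sub>1 ++ \<Gamma>\<^sub>2) = fv (M\<^bold>[N\<^bold>/0\<^bold>])"
    using 0 dom1 UnionE.IH(3) by (auto simp: subst_0 fv_scons)
  ultimately show ?case by blast
qed (auto intro: ltyping.intros split: if_splits)

definition env_on :: "nat set \<Rightarrow> (nat \<Rightarrow> 'a ty) \<Rightarrow> 'a env" where
  "env_on X E = (\<lambda>x. if x \<in> X then Some (E x) else None)"

lemma extend_env_on: "0 \<in> X \<Longrightarrow> extend \<sigma> (env_on {i. Suc i \<in> X} E) = env_on X (case_nat \<sigma> E)"
  by (auto simp: env_on_def extend_def fun_eq_iff split: nat.split)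

lemma env_on_Un: "env_on (X \<union> Y) E = env_on X E ++ env_on Y E"
  by (auto simp: env_on_def fun_eq_iff map_add_def)

lemma dom_env_on [simp]: "dom (env_on X E) = X"
  by (auto simp: env_on_def split: if_splits)

lemma ltyping_typing: "E \<tturnstile> M \<^bold>: \<rho> \<Longrightarrow> env_on (fv M) E \<turnstile> M \<^bold>: \<rho>"
proof (induction rule: ltyping.induct)
  case (Ax E x \<sigma>)
  have "env_on {x} E = [x \<mapsto> \<sigma>]" using Ax by (auto simp: env_on_def fun_eq_iff)
  then show ?case by (metis fv.simps(1) typing.Ax)
next
  case (ArrowI \<sigma> E M \<tau>)
  then show ?case by (simp add: typing.ArrowI extend_env_on)
next
  case ArrowE
  then show ?case by (simp add: env_on_Un typing.ArrowE)
next
  case (UnionE \<sigma> \<theta> E M \<rho> \<tau> N)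
  have "env_on {i. Suc i \<in> fv M} E ++ env_on (fv N) E \<turnstile> M\<^bold>[N\<^bold>/0\<^bold>] \<^bold>: \<rho>"
    by (rule typing.UnionE) (use UnionE in \<open>auto simp: extend_env_on\<close>)
  moreover have "fv (sub (case_nat N Var) M) = {i. Suc i \<in> fv M} \<union> fv N"
    using UnionE.hyps by (auto simp: fv_scons)
  ultimately show ?case by (simp add: subst_0 env_on_Un)
qed (blast intro: typing.intros)+

section \<open>Confluence\<close>

inductive par :: "tm \<Rightarrow> tm \<Rightarrow> bool" where
  par_Var: "par (Var i) (Var i)"
| par_App: "par M M' \<Longrightarrow> par N N' \<Longrightarrow> par (App M N) (App M' N')"
| par_Lam: "par M M' \<Longrightarrow> par (Lam M) (Lam M')"
| par_beta: "par M M' \<Longrightarrow> par N N' \<Longrightarrow> par (App (Lam M) N) (sub (case_nat N' Var) M')"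

inductive_cases par_VarE: "par (Var i) M"
inductive_cases par_LamE: "par (Lam M) N"

lemma par_refl: "par M M"
  by (induction M) (auto intro: par.intros)

lemma par_ren: "par M M' \<Longrightarrow> par (ren r M) (ren r M')"
proof (induction arbitrary: r rule: par.induct)
  case (par_beta M M' N N')
  let ?r = "case_nat 0 (\<lambda>i. Suc (r i))"
  have "par (App (Lam (ren ?r M)) (ren r N)) (sub (case_nat (ren r N') Var) (ren ?r M'))"
    using par_beta.IH by (intro par.par_beta)
  moreover have "sub (case_nat (ren r N') Var) (ren ?r M') = ren r (sub (case_nat N' Var) M')"
    unfolding sub_ren ren_sub by (rule sub_cong) (auto split: nat.split)
  ultimately show ?case by simp
qed (auto intro: par.intros)

lemma par_sub: "par M M' \<Longrightarrow> (\<And>i. par (s i) (s' i)) \<Longrightarrow> par (sub s M) (sub s' M')"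
proof (induction arbitrary: s s' rule: par.induct)
  case (par_Lam M M')
  have "par (up s i) (up s' i)" for i
    using par_Lam.prems by (cases i) (auto intro: par.intros par_ren)
  then show ?case by (auto intro: par.par_Lam par_Lam.IH)
next
  case (par_beta M M' N N')
  have "par (up s i) (up s' i)" for i
    using par_beta.prems by (cases i) (auto intro: par.intros par_ren)
  then have "par (App (Lam (sub (up s) M)) (sub s N)) (sub (case_nat (sub s' N') Var) (sub (up s') M'))"
    using par_beta by (intro par.par_beta) auto
  then show ?case by (simp add: sub_up_beta sub_beta)
qed (auto intro: par.intros)

text \<open>Takahashi's complete development.\<close>

fun dev :: "tm \<Rightarrow> tm" where
  "dev (Var i) = Var i"
| "dev (Lam M) = Lam (dev M)"
| "dev (App (Lam M) N) = sub (case_nat (dev N) Var) (dev M)"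
| "dev (App M N) = App (dev M) (dev N)"

lemma par_scons:
  assumes "par M M'" "par N N'" shows "par (sub (case_nat N Var) M) (sub (case_nat N' Var) M')"
  by (rule par_sub [OF assms(1)]) (use assms(2) in \<open>auto intro: par_refl split: nat.split\<close>)

text \<open>The triangle property: the target depends on \<open>M\<close> alone, so any two parallel
  reducts of \<open>M\<close> meet in one step.\<close>

lemma par_dev: "par M M' \<Longrightarrow> par M' (dev M)"
proof (induction rule: par.induct)
  case (par_App M M' N N')
  show ?case
  proof (cases M)
    case (Lam L)
    with par_App.hyps(1) obtain L' where "M' = Lam L'" by (auto elim: par_LamE)
    moreover have "par L' (dev L)"
      using par_App.IH(1) Lam \<open>M' = Lam L'\<close> by (auto elim: par_LamE)
    ultimately show ?thesis using Lam par_App.IH(2) by (auto intro: par.intros)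
  qed (use par_App in \<open>auto intro: par.intros\<close>)
qed (auto intro: par.intros par_scons)

lemma beta_root: "beta (App (Lam M) N) (sub (case_nat N Var) M)"
  using beta.intros(1) [of M N] by (simp add: subst_0)

lemma beta_par: "beta M M' \<Longrightarrow> par M M'"
  by (induction rule: beta.induct) (auto simp: subst_0 intro: par.intros par_refl)

lemma rtranclp_map:
  assumes "r\<^sup>*\<^sup>* x y" "\<And>x y. r x y \<Longrightarrow> r\<^sup>*\<^sup>* (f x) (f y)" shows "r\<^sup>*\<^sup>* (f x) (f y)"
  using assms(1) by (induction) (auto intro: assms(2) rtranclp_trans)

lemma betas_App: "beta\<^sup>*\<^sup>* M M' \<Longrightarrow> beta\<^sup>*\<^sup>* N N' \<Longrightarrow> beta\<^sup>*\<^sup>* (App M N) (App M' N')"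
  using rtranclp_map [of beta M M' "\<lambda>M. App M N"] rtranclp_map [of beta N N' "App M'"]
  by (auto intro: beta.intros rtranclp_trans)

lemma betas_Lam: "beta\<^sup>*\<^sup>* M M' \<Longrightarrow> beta\<^sup>*\<^sup>* (Lam M) (Lam M')"
  by (rule rtranclp_map) (auto intro: beta.intros)

lemma par_betas: "par M M' \<Longrightarrow> beta\<^sup>*\<^sup>* M M'"
proof (induction rule: par.induct)
  case (par_beta M M' N N')
  then have "beta\<^sup>*\<^sup>* (App (Lam M) N) (App (Lam M') N')" by (blast intro: betas_App betas_Lam)
  then show ?case using beta_root by (rule rtranclp.rtrancl_into_rtrancl)
qed (auto intro: betas_App betas_Lam)

lemma betas_eq_pars: "beta\<^sup>*\<^sup>* = par\<^sup>*\<^sup>*"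
proof (intro ext iffI)
  show "par\<^sup>*\<^sup>* M N" if "beta\<^sup>*\<^sup>* M N" for M N
    using that by (rule rtranclp_mono [THEN predicate2D, rotated]) (auto intro: beta_par)
  show "beta\<^sup>*\<^sup>* M N" if "par\<^sup>*\<^sup>* M N" for M N
    using that by (induction) (auto intro: par_betas rtranclp_trans)
qed

lemma confluentp_beta: "confluentp beta"
proof -
  have "strong_confluentp par"
  proof
    show "\<exists>K. par\<^sup>*\<^sup>* N K \<and> par\<^sup>=\<^sup>= L K" if "par M N" "par M L" for M N L
      using that [THEN par_dev] by blast
  qed
  then have "confluentp par" by (rule strong_confluentp_imp_confluentp)
  then show ?thesis by (simp add: confluentp_def betas_eq_pars rtranclp_conversep)
qed

lemma church_rosser:
  assumes "M =\<^sub>\<beta> N" obtains K where "beta\<^sup>*\<^sup>* M K" "beta\<^sup>*\<^sup>* N K"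
proof -
  have "(beta\<^sup>*\<^sup>* OO beta\<inverse>\<inverse>\<^sup>*\<^sup>*) M N"
    using assms semiconfluentp_equivclp confluentp_beta confluentp_imp_semiconfluentp by metis
  then show ?thesis using that by (auto simp: rtranclp_conversep)
qed

lemma equivclp_map:
  assumes "equivclp r x y" "\<And>x y. r x y \<Longrightarrow> r (f x) (f y)" shows "equivclp r (f x) (f y)"
  using assms(1)
proof (induction rule: equivclp_induct)
  case (step y z)
  then have "r (f y) (f z) \<or> r (f z) (f y)" using assms(2) by blast
  with step.IH show ?case by (blast intro: equivclp_into_equivclp)
qed simp

lemma beta_ren: "beta M M' \<Longrightarrow> beta (ren r M) (ren r M')"
proof (induction arbitrary: r rule: beta.induct)
  case (1 M N)
  have "sub (case_nat (ren r N) Var) (ren (case_nat 0 (\<lambda>i. Suc (r i))) M) = ren r (M\<^bold>[N\<^bold>/0\<^bold>])"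
    unfolding sub_ren ren_sub subst_0 by (rule sub_cong) (auto split: nat.split)
  then show ?case using beta_root by (metis ren.simps(2,3))
qed (auto intro: beta.intros)

lemma betas_sub: "(\<And>i. beta\<^sup>*\<^sup>* (s i) (s' i)) \<Longrightarrow> beta\<^sup>*\<^sup>* (sub s M) (sub s' M)"
proof (induction M arbitrary: s s')
  case (Lam M)
  have "beta\<^sup>*\<^sup>* (up s i) (up s' i)" for i
    by (cases i) (auto intro: rtranclp_map [OF Lam.prems] beta_ren)
  then show ?case by (auto intro: betas_Lam Lam.IH)
qed (auto intro: betas_App)

lemma beta_lin: "beta M M' \<Longrightarrow> lin M \<Longrightarrow> lin M' \<and> fv M' = fv M"
proof (induction rule: beta.induct)
  case (1 M N)
  then have *: "lin M" "0 \<in> fv M" "lin N" "\<forall>i. Suc i \<in> fv M \<longrightarrow> i \<notin> fv N" by auto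
  have "lin (sub (case_nat N Var) M)"
    by (rule lin_sub) (use * in \<open>auto simp: disj_scons_Var split: nat.split\<close>)
  with * show ?case by (auto simp: subst_0 fv_scons)
qed auto

lemma betas_lin: "beta\<^sup>*\<^sup>* M M' \<Longrightarrow> lin M \<Longrightarrow> lin M' \<and> fv M' = fv M"
  by (induction rule: rtranclp_induct) (auto dest: beta_lin)

text \<open>This version also serves terms not known to be linear, such as the canonical form of a
  hereditary permutator.\<close>

lemma beta_fv: "beta M M' \<Longrightarrow> fv M' \<subseteq> fv M"
  by (induction rule: beta.induct) (auto simp: subst_0 fv_scons split: if_splits)

lemma betas_fv: "beta\<^sup>*\<^sup>* M M' \<Longrightarrow> fv M' \<subseteq> fv M"
  by (induction rule: rtranclp_induct) (auto dest: beta_fv)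

section \<open>Applications of a variable to closed terms\<close>

text \<open>The configuration to be excluded. Looking at the first argument is enough: if
  \<open>App (Var 0) N\<close> is linear without further free variables, then \<open>N\<close> is
  closed.\<close>

fun stuck :: "nat \<Rightarrow> tm \<Rightarrow> bool" where
  "stuck k (Var i) \<longleftrightarrow> False"
| "stuck k (App M N) \<longleftrightarrow> M = Var k \<and> fv N = {} \<or> stuck k M \<or> stuck k N"
| "stuck k (Lam M) \<longleftrightarrow> stuck (Suc k) M"

lemma stuck_fv: "stuck k M \<Longrightarrow> k \<in> fv M"
  by (induction M arbitrary: k) auto

lemma stuck_sub: "stuck j M \<Longrightarrow> s j = Var k \<Longrightarrow> stuck k (sub s M)"
  by (induction M arbitrary: j k s) (auto simp: fv_sub)

lemma stuck_sub_arg: "v \<in> fv M \<Longrightarrow> stuck k (s v) \<Longrightarrow> stuck k (sub s M)"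
proof (induction M arbitrary: v k s)
  case (Lam M)
  then show ?case using Lam.IH [of "Suc v" "Suc k" "up s"] by (auto simp: ren_sub_Var stuck_sub)
qed auto

text \<open>A linear redex never erases its argument, and closed arguments stay closed. Stuckness
  therefore reaches the common reduct supplied by confluence.\<close>

lemma stuck_beta: "beta M M' \<Longrightarrow> lin M \<Longrightarrow> stuck k M \<Longrightarrow> stuck k M'"
proof (induction arbitrary: k rule: beta.induct)
  case (1 M N)
  then consider "stuck (Suc k) M" | "stuck k N" by auto
  then show ?case
  proof cases
    case 1
    then show ?thesis by (auto simp: subst_0 intro: stuck_sub)
  next
    case 2
    then show ?thesis using "1.prems"(1) by (auto simp: subst_0 intro: stuck_sub_arg)
  qed
next
  case (2 M M' N)
  have "M \<noteq> Var k" using 2(1) by (auto elim: beta.cases)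
  with 2 show ?case by auto
next
  case (3 N N' M)
  then show ?case by (auto dest: beta_fv)
qed auto

lemma stuck_betas: "beta\<^sup>*\<^sup>* M M' \<Longrightarrow> lin M \<Longrightarrow> stuck k M \<Longrightarrow> stuck k M'"
  by (induction rule: rtranclp_induct) (auto dest: stuck_beta betas_lin)

section \<open>Head variables and their arguments\<close>

fun spine :: "nat \<Rightarrow> tm \<Rightarrow> bool" where
  "spine k (Var i) \<longleftrightarrow> i = k"
| "spine k (App M N) \<longleftrightarrow> spine k M"
| "spine k (Lam M) \<longleftrightarrow> False"

fun headed :: "nat \<Rightarrow> tm \<Rightarrow> bool" where
  "headed k (Lam M) \<longleftrightarrow> headed (Suc k) M"
| "headed k M \<longleftrightarrow> spine k M"

lemma spine_beta: "beta M M' \<Longrightarrow> spine k M \<Longrightarrow> spine k M'"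
  by (induction rule: beta.induct) auto

lemma spine_headed: "spine k M \<Longrightarrow> headed k M"
  by (cases M) auto

lemma headed_beta: "beta M M' \<Longrightarrow> headed k M \<Longrightarrow> headed k M'"
  by (induction arbitrary: k rule: beta.induct) (auto intro: spine_headed spine_beta)

lemma headed_betas: "beta\<^sup>*\<^sup>* M M' \<Longrightarrow> headed k M \<Longrightarrow> headed k M'"
  by (induction rule: rtranclp_induct) (auto intro: headed_beta)

lemma spine_fv: "spine k M \<Longrightarrow> k \<in> fv M"
  by (induction M) auto

lemma headed_fv: "headed k M \<Longrightarrow> k \<in> fv M"
  by (induction M arbitrary: k) (auto dest: spine_fv)

lemma spine_sub: "spine k M \<Longrightarrow> s k = Var j \<Longrightarrow> spine j (sub s M)"
  by (induction M) auto

lemma headed_sub: "headed k M \<Longrightarrow> s k = Var j \<Longrightarrow> headed j (sub s M)"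
  by (induction M arbitrary: k j s) (auto intro: spine_sub)

text \<open>Having a free variable is not stable under erasing reductions, hence the quantification
  over all reducts.\<close>

definition open_reducts :: "tm \<Rightarrow> bool" where
  "open_reducts M \<longleftrightarrow> (\<forall>N. beta\<^sup>*\<^sup>* M N \<longrightarrow> fv N \<noteq> {})"

text \<open>Each condition on an argument rules out one way of being stuck: being closed, or
  containing a stuck application of \<open>k\<close>.\<close>

fun free_spine :: "nat \<Rightarrow> tm \<Rightarrow> bool" where
  "free_spine k (Var i) \<longleftrightarrow> i = k"
| "free_spine k (App M N) \<longleftrightarrow> free_spine k M \<and> k \<notin> fv N \<and> open_reducts N"
| "free_spine k (Lam M) \<longleftrightarrow> False"

fun free_headed :: "nat \<Rightarrow> tm \<Rightarrow> bool" where
  "free_headed k (Lam M) \<longleftrightarrow> free_headed (Suc k) M"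
| "free_headed k M \<longleftrightarrow> free_spine k M"

lemma open_reducts_beta: "open_reducts M \<Longrightarrow> beta M M' \<Longrightarrow> open_reducts M'"
  unfolding open_reducts_def by (blast intro: converse_rtranclp_into_rtranclp)

lemma free_spine_beta: "beta M M' \<Longrightarrow> free_spine k M \<Longrightarrow> free_spine k M'"
  by (induction rule: beta.induct) (auto dest: beta_fv intro: open_reducts_beta)

lemma free_spine_free_headed: "free_spine k M \<Longrightarrow> free_headed k M"
  by (cases M) auto

lemma free_headed_beta: "beta M M' \<Longrightarrow> free_headed k M \<Longrightarrow> free_headed k M'"
  by (induction arbitrary: k rule: beta.induct)
    (auto dest: beta_fv intro: open_reducts_beta free_spine_beta free_spine_free_headed)

lemma free_headed_betas: "beta\<^sup>*\<^sup>* M M' \<Longrightarrow> free_headed k M \<Longrightarrow> free_headed k M'"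
  by (induction rule: rtranclp_induct) (auto intro: free_headed_beta)

lemma free_spine_not_stuck: "free_spine k M \<Longrightarrow> \<not> stuck k M"
  by (induction M) (auto simp: open_reducts_def dest: stuck_fv)

lemma free_headed_not_stuck: "free_headed k M \<Longrightarrow> \<not> stuck k M"
  by (induction M arbitrary: k) (auto simp: open_reducts_def dest: stuck_fv free_spine_not_stuck)

lemma headed_Lams: "headed k ((Lam ^^ n) M) \<longleftrightarrow> headed (k + n) M"
  by (induction n arbitrary: k) auto

lemma free_headed_Lams: "free_headed k ((Lam ^^ n) M) \<longleftrightarrow> free_headed (k + n) M"
  by (induction n arbitrary: k) auto

lemma spine_foldl: "spine k M \<Longrightarrow> spine k (foldl App M Ns)"
  by (induction Ns arbitrary: M) auto

lemma free_spine_foldl: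
  "free_spine k M \<Longrightarrow> \<forall>N\<in>set Ns. k \<notin> fv N \<and> open_reducts N \<Longrightarrow> free_spine k (foldl App M Ns)"
  by (induction Ns arbitrary: M) auto

section \<open>Hereditary permutators applied to a variable\<close>

lemma lifts_ren: "(lift 0 ^^ n) M = ren (\<lambda>i. i + n) M"
  by (induction n) (auto simp: lift_0 ren_ren ren_id)

lemma App_conv_body:
  assumes "P =\<^sub>\<beta> Lam M"
  shows "App (ren r P) (Var k) =\<^sub>\<beta> sub (case_nat (Var k) (\<lambda>i. Var (r i))) M"
proof -
  have "App (ren r P) (Var k) =\<^sub>\<beta> App (ren r (Lam M)) (Var k)"
    using assms by (rule equivclp_map) (auto intro: beta.intros beta_ren)
  moreover have "beta (App (ren r (Lam M)) (Var k)) (sub (case_nat (Var k) (\<lambda>i. Var (r i))) M)"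
  proof -
    have "sub (case_nat (Var k) (\<lambda>i. Var (r i))) M =
        sub (case_nat (Var k) Var) (ren (case_nat 0 (\<lambda>i. Suc (r i))) M)"
      unfolding sub_ren by (rule sub_cong) (auto split: nat.split)
    then show ?thesis by (simp add: beta_root)
  qed
  ultimately show ?thesis by (blast intro: equivclp_into_equivclp)
qed

text \<open>The application converts to a term with head variable \<open>k\<close>. Head variables
  persist and reduction creates no free variables, so by confluence every reduct still contains
  \<open>k\<close>. The outermost layer of \<open>P\<close> gives all this without
  induction.\<close>

lemma fhp_open_reducts:
  assumes "fhp P" shows "open_reducts (App (ren r P) (Var k))"
  unfolding open_reducts_def
proof (intro allI impI)
  fix N assume N: "beta\<^sup>*\<^sup>* (App (ren r P) (Var k)) N"
  obtain n Ns where "P =\<^sub>\<beta> Lam ((Lam ^^ n) (foldl App (Var n) Ns))" (is "_ =\<^sub>\<beta> Lam ?M")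
    using assms by (cases rule: fhp.cases) auto
  from App_conv_body [OF this] have "N =\<^sub>\<beta> sub (case_nat (Var k) (\<lambda>i. Var (r i))) ?M"
    using N by (meson equivclp_sym equivclp_trans rtranclp_into_equivclp)
  moreover have "headed k (sub (case_nat (Var k) (\<lambda>i. Var (r i))) ?M)"
    by (rule headed_sub [where k = 0]) (simp_all add: headed_Lams spine_headed spine_foldl)
  ultimately obtain K where "beta\<^sup>*\<^sup>* N K" "headed k K"
    by (metis church_rosser headed_betas)
  then show "fv N \<noteq> {}" using headed_fv betas_fv by blast
qed

lemma fhp_conv_free_headed:
  assumes "fhp P" obtains M where "P =\<^sub>\<beta> Lam M" "free_headed 0 M"
  using assms
proof (cases rule: fhp.cases)
  case (1 \<pi> n Q)
  let ?Ns = "map (\<lambda>i. App ((lift 0 ^^ Suc n) (Q i)) (Var (n - \<pi> i))) [1..<Suc n]"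
  have "n \<notin> fv N \<and> open_reducts N" if N: "N \<in> set ?Ns" for N
  proof -
    obtain i where i: "i \<in> {1..n}" "N = App ((lift 0 ^^ Suc n) (Q i)) (Var (n - \<pi> i))"
      using N by fastforce
    \<comment> \<open>Thus \<open>n - \<pi> i\<close> is below \<open>n\<close>, the index of the
      head variable, while the free variables of the lifted \<open>Q i\<close> are above it.\<close>
    have "\<pi> i \<in> {1..n}" using 1(1) i(1) permutes_in_image by metis
    then show ?thesis
      using i 1(2) unfolding i(2) lifts_ren by (auto simp: fv_ren intro!: fhp_open_reducts)
  qed
  then have "free_headed 0 ((Lam ^^ n) (foldl App (Var n) ?Ns))"
    by (simp add: free_headed_Lams free_spine_free_headed free_spine_foldl del: set_map)
  moreover have "P =\<^sub>\<beta> Lam ((Lam ^^ n) (foldl App (Var n) ?Ns))" using 1(3) by simp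
  ultimately show ?thesis using that by blast
qed

definition good :: "tm \<Rightarrow> bool" where
  "good M \<longleftrightarrow> lin M \<and> fv M \<subseteq> {0} \<and> (\<forall>N. beta\<^sup>*\<^sup>* M N \<longrightarrow> \<not> stuck 0 N)"

text \<open>A stuck reduct would have a common reduct with the canonical body, and that term would
  be both stuck and \<open>free_headed\<close>.\<close>

lemma good_fhp_App:
  assumes P: "fhp P" "lin P" "fv P = {}" shows "good (App P (Var 0))"
  unfolding good_def
proof (intro conjI allI impI notI)
  show lin: "lin (App P (Var 0))" and "fv (App P (Var 0)) \<subseteq> {0}" using P by auto
  fix N assume N: "beta\<^sup>*\<^sup>* (App P (Var 0)) N" "stuck 0 N"
  obtain M where M: "P =\<^sub>\<beta> Lam M" "free_headed 0 M" using P(1) by (rule fhp_conv_free_headed)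
  \<comment> \<open>The renaming \<open>Suc\<close> leaves the closed term \<open>P\<close>
    unchanged and turns the substitution in the body into the identity.\<close>
  have "App P (Var 0) =\<^sub>\<beta> sub (case_nat (Var 0) (\<lambda>i. Var (Suc i))) M"
    using App_conv_body [OF M(1), of Suc 0] ren_id [of P Suc] P(3) by (metis empty_iff)
  moreover have "sub (case_nat (Var 0) (\<lambda>i. Var (Suc i))) M = M"
    by (rule sub_id) (auto split: nat.split)
  ultimately have "N =\<^sub>\<beta> M"
    using N(1) by (metis equivclp_sym equivclp_trans rtranclp_into_equivclp)
  then obtain K where K: "beta\<^sup>*\<^sup>* N K" "beta\<^sup>*\<^sup>* M K" by (rule church_rosser)
  have "stuck 0 K" using stuck_betas [OF K(1) _ N(2)] betas_lin [OF N(1) lin] by blast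
  moreover have "free_headed 0 K" using free_headed_betas K(2) M(2) .
  ultimately show False using free_headed_not_stuck by blast
qed

lemma good_beta: "good M \<Longrightarrow> beta M M' \<Longrightarrow> good M'"
  unfolding good_def using beta_lin by (blast intro: converse_rtranclp_into_rtranclp)

lemma lin_sub_arg: "lin (sub s M) \<Longrightarrow> v \<in> fv M \<Longrightarrow> lin (s v)"
proof (induction M arbitrary: s v)
  case (Lam M)
  then have "lin (up s (Suc v))" using Lam.IH [of "up s" "Suc v"] by auto
  then have "lin (ren (\<lambda>i. i - 1) (ren Suc (s v)))"
    by (intro lin_ren [of "ren Suc (s v)"]) (auto simp: fv_ren inj_on_def)
  then show ?case by (simp add: ren_ren ren_id)
qed auto

text \<open>Reducing \<open>s v\<close> in place reduces the whole term, where a stuck part stays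
  visible. Goodness is thus inherited by both parts of an application and by the term eliminated in
  a union elimination.\<close>

lemma good_sub_arg:
  assumes "good (sub s M)" "v \<in> fv M" shows "good (s v)"
  unfolding good_def
proof (intro conjI allI impI notI)
  show "lin (s v)" using assms lin_sub_arg by (auto simp: good_def)
  show "fv (s v) \<subseteq> {0}" using assms by (auto simp: good_def fv_sub)
  fix N assume N: "beta\<^sup>*\<^sup>* (s v) N" "stuck 0 N"
  then have "beta\<^sup>*\<^sup>* (sub s M) (sub (s(v := N)) M)" by (intro betas_sub) auto
  moreover have "stuck 0 (sub (s(v := N)) M)" by (rule stuck_sub_arg [OF assms(2)]) (simp add: N)
  ultimately show False using assms(1) by (auto simp: good_def)
qed

lemma good_App: "good (App M N) \<Longrightarrow> good M \<and> good N"
  using good_sub_arg [of "case_nat M (\<lambda>_. N)" "App (Var 0) (Var 1)" 0]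
    good_sub_arg [of "case_nat M (\<lambda>_. N)" "App (Var 0) (Var 1)" 1] by simp

lemma good_Var: "good (Var 0)"
  unfolding good_def by (auto elim: converse_rtranclpE beta.cases)

lemma not_good_App_Var: "\<not> good (App (Var 0) N)"
proof
  assume "good (App (Var 0) N)"
  then have "\<not> stuck 0 (App (Var 0) N)" "fv N \<subseteq> {0}" "0 \<notin> fv N" by (auto simp: good_def)
  then show False by auto
qed

section \<open>Reducibility\<close>

lemma whr_beta: "whr M M' \<Longrightarrow> beta M M'"
  by (induction rule: whr.induct) (auto intro: beta.intros beta_root)

fun is_value :: "tm \<Rightarrow> bool" where
  "is_value (App M N) \<longleftrightarrow> False"
| "is_value M \<longleftrightarrow> True"

inductive_cases whr_AppE: "whr (App M N) K"

lemma is_value_not_whr: "is_value V \<Longrightarrow> \<not> whr V M"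
  by (auto elim: whr.cases)

lemma whr_det: "whr M N \<Longrightarrow> whr M K \<Longrightarrow> N = K"
proof (induction arbitrary: K rule: whr.induct)
  case (1 M N)
  then show ?case by (cases rule: whr_AppE) (auto simp: is_value_not_whr)
next
  case (2 M M' N)
  from 2(3,1) show ?case
    by (cases rule: whr_AppE) (auto simp: is_value_not_whr dest: 2(2))
qed

lemma whrs_value: "whr\<^sup>*\<^sup>* M V \<Longrightarrow> is_value V \<Longrightarrow> whr\<^sup>*\<^sup>* M N \<Longrightarrow> whr\<^sup>*\<^sup>* N V"
proof (induction rule: converse_rtranclp_induct)
  case base
  then show ?case by (auto elim: converse_rtranclpE dest: is_value_not_whr [rotated])
next
  case (step M M')
  from step.prems(2) show ?case
  proof (cases rule: converse_rtranclpE)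
    case base
    with step show ?thesis by (metis converse_rtranclp_into_rtranclp)
  next
    case (step K)
    with whr_det \<open>whr M M'\<close> \<open>is_value V\<close> step.IH show ?thesis by metis
  qed
qed

text \<open>
  Membership is tested at the weak head normal form because typing is only known to be
  preserved by weak head expansion, not by reduction. In the arrow clause of \<open>reducible\<close> the
  restriction to good applications makes the variable \<open>0\<close> reducible at every arrow type it has.
\<close>

definition evals :: "(nat \<Rightarrow> 'a ty) \<Rightarrow> tm \<Rightarrow> 'a ty \<Rightarrow> bool" where
  "evals E M \<sigma> \<longleftrightarrow> (\<exists>V. whr\<^sup>*\<^sup>* M V \<and> is_value V \<and> E \<tturnstile> V \<^bold>: \<sigma>)"

primrec reducible :: "(nat \<Rightarrow> 'a ty) \<Rightarrow> 'a ty \<Rightarrow> tm \<Rightarrow> bool" where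
  "reducible E (Atom a) M \<longleftrightarrow> good M \<and> evals E M (Atom a)"
| "reducible E (\<sigma> \<^bold>\<rightarrow> \<tau>) M \<longleftrightarrow> good M \<and> evals E M (\<sigma> \<^bold>\<rightarrow> \<tau>) \<and>
    (\<forall>N. reducible E \<sigma> N \<longrightarrow> good (App M N) \<longrightarrow> reducible E \<tau> (App M N))"
| "reducible E (\<sigma> \<^bold>\<and> \<tau>) M \<longleftrightarrow> reducible E \<sigma> M \<and> reducible E \<tau> M"
| "reducible E (\<sigma> \<^bold>\<or> \<tau>) M \<longleftrightarrow> reducible E \<sigma> M \<or> reducible E \<tau> M"

lemma evals_Inter: "evals E M \<sigma> \<Longrightarrow> evals E M \<tau> \<Longrightarrow> evals E M (\<sigma> \<^bold>\<and> \<tau>)"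
  unfolding evals_def
proof (elim exE conjE)
  fix V W assume *: "whr\<^sup>*\<^sup>* M V" "is_value V" "E \<tturnstile> V \<^bold>: \<sigma>" "whr\<^sup>*\<^sup>* M W" "is_value W" "E \<tturnstile> W \<^bold>: \<tau>"
  then have "whr\<^sup>*\<^sup>* V W" by (auto intro: whrs_value)
  then have "V = W" using *(2) by (auto elim: converse_rtranclpE dest: is_value_not_whr [rotated])
  with * show "\<exists>V. whr\<^sup>*\<^sup>* M V \<and> is_value V \<and> E \<tturnstile> V \<^bold>: \<sigma> \<^bold>\<and> \<tau>" by (auto intro: InterI)
qed

lemma reducible_evals: "reducible E \<sigma> M \<Longrightarrow> evals E M \<sigma>"
proof (induction \<sigma>)
  case (Union \<sigma> \<tau>)
  then show ?case by (auto simp: evals_def intro: UnionI1 UnionI2)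
qed (auto intro: evals_Inter)

lemma reducible_good: "reducible E \<sigma> M \<Longrightarrow> good M"
  by (induction \<sigma>) auto

lemma whrs_ltyping: "whr\<^sup>*\<^sup>* M N \<Longrightarrow> lin M \<Longrightarrow> E \<tturnstile> N \<^bold>: \<sigma> \<Longrightarrow> E \<tturnstile> M \<^bold>: \<sigma>"
  by (induction rule: converse_rtranclp_induct) (auto intro: whr_ltyping dest: whr_beta beta_lin)

lemma reducible_ltyping: "reducible E \<sigma> M \<Longrightarrow> E \<tturnstile> M \<^bold>: \<sigma>"
  using reducible_evals [of E \<sigma> M] reducible_good [of E \<sigma> M]
  by (auto simp: evals_def good_def intro: whrs_ltyping)

lemma reducible_expand: "whr M M' \<Longrightarrow> good M \<Longrightarrow> reducible E \<sigma> M' \<Longrightarrow> reducible E \<sigma> M"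
proof (induction \<sigma> arbitrary: M M')
  case (Atom a)
  then show ?case by (auto simp: evals_def intro: converse_rtranclp_into_rtranclp)
next
  case (Arrow \<sigma> \<tau>)
  have "reducible E \<tau> (App M N)" if "reducible E \<sigma> N" "good (App M N)" for N
  proof (rule Arrow.IH(2))
    show "whr (App M N) (App M' N)" using Arrow.prems(1) by (rule whr.intros)
    then have "good (App M' N)" using that(2) whr_beta good_beta by blast
    then show "reducible E \<tau> (App M' N)" using Arrow.prems(3) that(1) by simp
  qed (fact that)
  with Arrow.prems show ?case by (auto simp: evals_def intro: converse_rtranclp_into_rtranclp)
qed auto

text \<open>Goodness has to be assumed, and it passes to the premises through
  \<open>good_App\<close>, \<open>good_sub_arg\<close> and \<open>good_beta\<close>. Reducibility at
  a union is a genuine disjunction, so union elimination simply selects one of its two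
  branches.\<close>

lemma fundamental:
  "F \<tturnstile> M \<^bold>: \<rho> \<Longrightarrow> \<forall>v\<in>fv M. reducible E (F v) (s v) \<Longrightarrow> disj s (fv M) \<Longrightarrow> good (sub s M) \<Longrightarrow>
    reducible E \<rho> (sub s M)"
proof (induction arbitrary: s rule: ltyping.induct)
  case (ArrowI \<sigma> F M \<tau>)
  have "F \<tturnstile> Lam M \<^bold>: \<sigma> \<^bold>\<rightarrow> \<tau>" using ArrowI.hyps by (rule ltyping.ArrowI)
  then have "E \<tturnstile> sub s (Lam M) \<^bold>: \<sigma> \<^bold>\<rightarrow> \<tau>"
    by (rule ltyping_sub) (use ArrowI.prems in \<open>auto intro: reducible_ltyping\<close>)
  then have "evals E (sub s (Lam M)) (\<sigma> \<^bold>\<rightarrow> \<tau>)" by (auto simp: evals_def)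
  moreover have "reducible E \<tau> (App (sub s (Lam M)) N)"
    if N: "reducible E \<sigma> N" and g: "good (App (sub s (Lam M)) N)" for N
  proof -
    have whr: "whr (App (sub s (Lam M)) N) (sub (case_nat N s) M)"
      using whr.intros(1) [of "sub (up s) M" N] by (simp add: sub_up_beta)
    have "reducible E \<tau> (sub (case_nat N s) M)"
    proof (rule ArrowI.IH)
      show "\<forall>v\<in>fv M. reducible E (case_nat \<sigma> F v) (case_nat N s v)"
        using N ArrowI.prems(1) by (auto split: nat.split)
      have "fv (sub s (Lam M)) \<inter> fv N = {}" using g by (simp add: good_def)
      then show "disj (case_nat N s) (fv M)"
        using ArrowI.prems(2) by (intro disj_scons) (auto simp: fv_sub [of s "Lam M"] simp del: sub.simps)
      show "good (sub (case_nat N s) M)" using g whr whr_beta good_beta by blast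
    qed
    then show ?thesis using reducible_expand whr g by blast
  qed
  ultimately show ?case using ArrowI.prems(3) by simp
next
  case (ArrowE F M \<sigma> \<tau> N)
  have "good (sub s M) \<and> good (sub s N)" using good_App [of "sub s M" "sub s N"] ArrowE.prems(3) by simp
  then have "reducible E (\<sigma> \<^bold>\<rightarrow> \<tau>) (sub s M)" "reducible E \<sigma> (sub s N)"
    using ArrowE.prems by (auto intro!: ArrowE.IH simp del: reducible.simps elim: disj_subset)
  then show ?case using ArrowE.prems(3) by simp
next
  case (UnionE \<sigma> \<theta> F M \<rho> \<tau> N)
  have eq: "sub s (sub (case_nat N Var) M) = sub (case_nat (sub s N) s) M" by (rule sub_beta)
  have fv: "fv (sub (case_nat N Var) M) = fv N \<union> {i. Suc i \<in> fv M}"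
    using UnionE.hyps by (auto simp: fv_scons)
  have good: "good (sub (case_nat (sub s N) s) M)" using UnionE.prems(3) eq by simp
  have "good (sub s N)" using good_sub_arg [OF good UnionE.hyps(4)] by simp
  then have N: "reducible E ((\<sigma> \<^bold>\<or> \<tau>) \<^bold>\<and> \<theta>) (sub s N)"
    using UnionE.prems fv by (intro UnionE.IH) (auto simp del: reducible.simps elim: disj_subset)
  have disj: "disj (case_nat (sub s N) s) (fv M)"
  proof (rule disj_scons)
    show "disj s {i. Suc i \<in> fv M}" using UnionE.prems(2) fv by (auto elim: disj_subset)
    show "fv (sub s N) \<inter> fv (s i) = {}" if "Suc i \<in> fv M" for i
    proof -
      have "disj s (fv N \<union> fv (Var i))"
        using UnionE.prems(2) that by (auto simp: fv elim: disj_subset)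
      then show ?thesis using disj_fv_sub [of s N "Var i"] UnionE.hyps(5) that by auto
    qed
  qed
  from N consider "reducible E (\<sigma> \<^bold>\<and> \<theta>) (sub s N)" | "reducible E (\<tau> \<^bold>\<and> \<theta>) (sub s N)" by auto
  then show ?case
  proof cases
    case 1
    then show ?thesis unfolding eq
      by (intro UnionE.IH(1) disj good)
        (use UnionE.prems(1) fv in \<open>auto simp del: reducible.simps split: nat.split\<close>)
  next
    case 2
    then show ?thesis unfolding eq
      by (intro UnionE.IH(2) disj good)
        (use UnionE.prems(1) fv in \<open>auto simp del: reducible.simps split: nat.split\<close>)
  qed
qed auto

text \<open>By \<open>not_good_App_Var\<close> the condition on applications is vacuous. Unions are
  excluded since a variable of union type need not have either member as a type.\<close>

lemma reducible_Var:
  "basic_inter \<mu> \<Longrightarrow> E \<tturnstile> Var 0 \<^bold>: \<mu> \<Longrightarrow> reducible E \<mu> (Var 0)"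
proof (induction rule: basic_inter.induct)
  case (1 \<alpha>)
  then have "evals E (Var 0) \<alpha>" by (auto simp: evals_def)
  with 1 show ?case by (cases \<alpha>) (auto simp: good_Var not_good_App_Var)
qed (auto intro: InterE1 InterE2)

section \<open>Unions and weak normal forms\<close>

lemma reducible_foldl: "reducible E (foldl Union \<sigma> \<tau>s) M \<longleftrightarrow> (\<exists>\<tau>\<in>set (\<sigma> # \<tau>s). reducible E \<tau> M)"
  by (induction \<tau>s arbitrary: \<sigma>) auto

lemma reducible_big_union:
  "\<sigma>s \<noteq> [] \<Longrightarrow> reducible E (\<^bold>\<Or> \<sigma>s) M \<longleftrightarrow> (\<exists>\<sigma>\<in>set \<sigma>s. reducible E \<sigma> M)"
  by (cases \<sigma>s) (auto simp: big_union_def reducible_foldl)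

lemma reducible_disjuncts: "reducible E \<sigma> M \<longleftrightarrow> (\<exists>\<mu>\<in>set (disjuncts \<sigma>). reducible E \<mu> M)"
  by (induction \<sigma> rule: disjuncts.induct) auto

lemma disjuncts_nonempty: "disjuncts \<sigma> \<noteq> []"
  by (induction \<sigma> rule: disjuncts.induct) auto

lemma reducible_w: "reducible E (w \<sigma>) M \<longleftrightarrow> reducible E \<sigma> M"
proof (induction \<sigma>)
  case (Inter \<sigma> \<tau>)
  have "[\<mu> \<^bold>\<and> \<nu>. \<mu> \<leftarrow> disjuncts (w \<sigma>), \<nu> \<leftarrow> disjuncts (w \<tau>)] \<noteq> []"
    using disjuncts_nonempty by (cases "disjuncts (w \<sigma>)") (auto simp: disjuncts_nonempty)
  then have "reducible E (w (\<sigma> \<^bold>\<and> \<tau>)) M \<longleftrightarrow> reducible E (w \<sigma>) M \<and> reducible E (w \<tau>) M"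
    using reducible_disjuncts [of E "w \<sigma>" M] reducible_disjuncts [of E "w \<tau>" M]
    by (auto simp: reducible_big_union)
  then show ?case using Inter by simp
qed auto

lemma reducible_aci: "\<sigma> \<approx> \<tau> \<Longrightarrow> reducible E \<sigma> M \<longleftrightarrow> reducible E \<tau> M"
  by (induction rule: aci.induct) auto

section \<open>The theorem\<close>

theorem mainTheorem4:
  fixes P :: tm and \<sigma> \<tau> :: "'a ty" and \<mu> \<nu> :: "'a ty list"
  assumes "fhp P"
    and "\<mu> \<noteq> []" and "\<forall>i<length \<mu>. basic_inter (\<mu> ! i)" and "w \<sigma> \<approx> \<^bold>\<Or> \<mu>"
    and "\<nu> \<noteq> []" and "\<forall>j<length \<nu>. basic_inter (\<nu> ! j)" and "w \<tau> \<approx> \<^bold>\<Or> \<nu>"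
    and "Map.empty \<turnstile> P \<^bold>: \<sigma> \<^bold>\<rightarrow> \<tau>"
  shows "\<forall>i<length \<mu>. \<exists>j<length \<nu>. Map.empty \<turnstile> P \<^bold>: \<mu> ! i \<^bold>\<rightarrow> \<nu> ! j"
proof (intro allI impI)
  fix i assume i: "i < length \<mu>"
  \<comment> \<open>A constant environment is its own extension by \<open>?\<mu>\<close>, so the
    body of an abstraction can be typed in it as well.\<close>
  let ?\<mu> = "\<mu> ! i" and ?E = "\<lambda>_ :: nat. \<mu> ! i"
  have fv: "fv P = {}" and P: "?E \<tturnstile> P \<^bold>: \<sigma> \<^bold>\<rightarrow> \<tau>"
    using typing_ltyping [OF assms(8)] by auto
  have lin: "lin P" using P by (rule ltyping_lin)
  have good: "good (App P (Var 0))" using assms(1) lin fv by (rule good_fhp_App)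
  have "reducible ?E (\<sigma> \<^bold>\<rightarrow> \<tau>) (sub Var P)"
    by (rule fundamental [OF P]) (use good_App [OF good] fv in auto)
  then have red: "reducible ?E (\<sigma> \<^bold>\<rightarrow> \<tau>) P" by simp
  have "reducible ?E ?\<mu> (Var 0)"
    by (rule reducible_Var) (use assms(3) i in \<open>auto intro: Ax\<close>)
  then have "reducible ?E (\<^bold>\<Or> \<mu>) (Var 0)" using assms(2) i by (auto simp: reducible_big_union)
  then have "reducible ?E \<sigma> (Var 0)" using reducible_aci [OF assms(4)] reducible_w by blast
  then have "reducible ?E \<tau> (App P (Var 0))" using red good by simp
  then have "reducible ?E (\<^bold>\<Or> \<nu>) (App P (Var 0))"
    using reducible_aci [OF assms(7)] reducible_w by blast
  then obtain j where j: "j < length \<nu>" and Px: "reducible ?E (\<nu> ! j) (App P (Var 0))"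
    using assms(5) by (auto simp: reducible_big_union in_set_conv_nth)
  \<comment> \<open>The type \<open>\<nu> ! j\<close> is known for the value of the application. It
    is carried back by expansion to the body of \<open>V\<close>, abstracted there, and carried back
    to \<open>P\<close>.\<close>
  from red obtain V where V: "whr\<^sup>*\<^sup>* P V" "is_value V" by (auto simp: evals_def)
  have "beta\<^sup>*\<^sup>* P V"
    using V(1) by (rule rtranclp_mono [THEN predicate2D, rotated]) (auto intro: whr_beta)
  then have V': "lin V" "fv V = {}" using betas_lin lin fv by auto
  with V(2) obtain M where M: "V = Lam M" by (cases V) auto
  \<comment> \<open>As \<open>V\<close> is closed, its bound variable can be identified with the
    free variable 0, and contracting \<open>App V (Var 0)\<close> returns exactly the body.\<close>
  have "sub (case_nat (Var 0) Var) M = M"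
  proof (rule sub_id)
    fix k assume "k \<in> fv M"
    then have "k = 0" using V'(2) M by (cases k) auto
    then show "case_nat (Var 0) Var k = Var k" by simp
  qed
  then have "whr (App V (Var 0)) M" using whr.intros(1) [of M "Var 0"] M by simp
  moreover have "whr\<^sup>*\<^sup>* (App P (Var 0)) (App V (Var 0))"
    by (rule rtranclp_map [OF V(1)]) (auto intro: whr.intros)
  ultimately have "whr\<^sup>*\<^sup>* (App P (Var 0)) M" by simp
  moreover obtain W where W: "whr\<^sup>*\<^sup>* (App P (Var 0)) W" "is_value W" "?E \<tturnstile> W \<^bold>: \<nu> ! j"
    using reducible_evals [OF Px] by (auto simp: evals_def)
  ultimately have "whr\<^sup>*\<^sup>* M W" using whrs_value by blast
  then have "?E \<tturnstile> M \<^bold>: \<nu> ! j" using V'(1) W(3) M by (auto intro: whrs_ltyping)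
  then have "case_nat ?\<mu> ?E \<tturnstile> M \<^bold>: \<nu> ! j"
    by (rule ltyping_env_cong) (auto split: nat.split)
  then have "?E \<tturnstile> V \<^bold>: ?\<mu> \<^bold>\<rightarrow> \<nu> ! j" using V'(1) M by (auto intro: ArrowI)
  then have "?E \<tturnstile> P \<^bold>: ?\<mu> \<^bold>\<rightarrow> \<nu> ! j" using V(1) lin by (blast intro: whrs_ltyping)
  from ltyping_typing [OF this] have "Map.empty \<turnstile> P \<^bold>: ?\<mu> \<^bold>\<rightarrow> \<nu> ! j"
    by (simp add: fv env_on_def)
  with j show "\<exists>j<length \<nu>. Map.empty \<turnstile> P \<^bold>: \<mu> ! i \<^bold>\<rightarrow> \<nu> ! j" by blast
qed

end
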